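(* There is a universal constant $c>0$ such that the following holds. Let $\sigma>0$, let $n,d$ be integers with $d\ge n\ge4$, let $k\ge2$ be an integer, and let $\gamma\ge0$ and $R\ge\sigma/\sqrt n$ be scalars. Then there is a design matrix $X\in\mathbb{R}^{n\times d}$ satisfying the column normalization condition $\|X_j\|_2/\sqrt n\le1$ for every column $X_j$, $j=1,\dots,d$, such that for every regularizer $\rho$ satisfying conditions (i)–(v) of the context, with the local descent algorithm of the context run with a stepsize $\eta>0$ satisfying $$\eta\le\min\Big\{B,\frac{B}{\lambda H}\Big\},\qquad B:=\frac{\sigma}{4\sqrt n},$$ (where $H$ is the constant in condition (v)): (a) the local descent algorithm terminates after a finite number of steps $T$ at a vector $\widehat\theta=\theta^{T+1}$ that is a local minimum of the loss function $L(\cdot;\lambda)$; (b) given a random initialization $\theta^0\sim N(0,\gamma^2I_{d\times d})$, the resulting local minimum $\widehat\theta$ (which depends on $\lambda$) satisfies $$\sup_{\theta^*\in\mathbb{B}_0(k)\cap\mathbb{B}_1(R)}\mathbb{E}\Big[\inf_{\lambda\ge0}\ \tfrac1n\|X\widehat\theta-X\theta^*\|_2^2\Big]\ \ge\ c\,\min\{R,\sigma\}\,\frac{\sigma}{\sqrt n}.$$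
   Context: Model: $y=X\theta^*+w\in\mathbb{R}^n$, where $X\in\mathbb{R}^{n\times d}$ is deterministic and $w$ has i.i.d. $N(0,\sigma^2)$ entries. The random initialization is independent of $w$, and the expectation is over both $w$ and the initialization (and any tie-breaking randomness). $\mathbb{B}_0(k)\subset\mathbb{R}^d$ is the set of vectors with at most $k$ non-zero entries; $\mathbb{B}_1(R)=\{\theta\in\mathbb{R}^d:\|\theta\|_1\le R\}$. Conditions on the regularizer $\rho:\mathbb{R}^d\to\mathbb{R}$: (i) $\rho(\theta)=\sum_{j=1}^d\rho_j(\theta_j)$ for univariate functions $\rho_j:\mathbb{R}\to\mathbb{R}$; (ii) $\rho_j(0)=0$ and $\rho_j(t)=\rho_j(-t)$ for all $t$; (iii) each $\rho_j$ is nondecreasing on $[0,\infty)$; (iv) each $\rho_j$ is continuous at the origin; (v) each $\rho_j$ is differentiable on $(0,\infty)$ and there is a constant $H\ge0$ such that $|\rho_j'(x)-\rho_j'(\tilde x)|\le H|x-\tilde x|$ for all $x,\tilde x\in(0,\infty)$ and all $j$. For $\lambda\ge0$ let $L(\theta;\lambda)=\frac1n\|y-X\theta\|_2^2+\lambda\rho(\theta)$. A local minimum of $L(\cdot;\lambda)$ is a point minimizing $L(\cdot;\lambda)$ over some open ball centered at it. Local descent algorithm with stepsize $\eta>0$ (which may depend on $\lambda$): starting from $\theta^0$, iterate $$\theta^{t+1}\in\arg\min_{\theta:\ \|\theta-\theta^t\|_2\le\eta}L(\theta;\lambda).$$ If several points achieve the minimum, the algorithm chooses one closest to $\theta^t$,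 resolving any remaining ties by randomization. The algorithm terminates when there is a minimizer belonging to the interior of the ball $\{\theta:\|\theta-\theta^t\|_2\le\eta\}$, in which case $\theta^{t+1}$ is a local minimum. Convention: $B/(\lambda H)=+\infty$ if $\lambda H=0$. *)

theory Defs
  imports "HOL-Probability.Probability"
begin

text \<open>
  The dimensions \<open>n\<close> and \<open>d\<close> are quantified inside the scope of a universal constant, so
  \<open>\<real>\<^sup>d\<close> is represented by the extensional functions on \<open>{..<d}\<close> (the space of the product measure
  \<^const>\<open>PiM\<close> over \<open>{..<d}\<close>). An \<open>n \<times> d\<close> matrix is a function
  \<open>X :: nat \<Rightarrow> nat \<Rightarrow> real\<close> of which only the entries \<open>X i j\<close> with \<open>i < n\<close>, \<open>j < d\<close> are used.
\<close>

type_synonym rvec = "nat \<Rightarrow> real"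
type_synonym rmat = "nat \<Rightarrow> nat \<Rightarrow> real"

definition Rspace :: "nat \<Rightarrow> rvec set" where
  "Rspace m = {..<m} \<rightarrow>\<^sub>E UNIV"

definition vdist :: "nat \<Rightarrow> rvec \<Rightarrow> rvec \<Rightarrow> real" where
  "vdist m x z = L2_set (\<lambda>i. x i - z i) {..<m}"

definition mat_app :: "nat \<Rightarrow> nat \<Rightarrow> rmat \<Rightarrow> rvec \<Rightarrow> rvec" where
  "mat_app n d X \<theta> = (\<lambda>i\<in>{..<n}. \<Sum>j<d. X i j * \<theta> j)"

definition column_normalized :: "nat \<Rightarrow> nat \<Rightarrow> rmat \<Rightarrow> bool" where
  "column_normalized n d X \<longleftrightarrow> (\<forall>j<d. L2_set (\<lambda>i. X i j) {..<n} / sqrt (real n) \<le> 1)"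

definition B0 :: "nat \<Rightarrow> nat \<Rightarrow> rvec set" where
  "B0 d k = {\<theta> \<in> Rspace d. card {j. j < d \<and> \<theta> j \<noteq> 0} \<le> k}"

definition B1 :: "nat \<Rightarrow> real \<Rightarrow> rvec set" where
  "B1 d R = {\<theta> \<in> Rspace d. (\<Sum>j<d. \<bar>\<theta> j\<bar>) \<le> R}"

definition regularizer :: "nat \<Rightarrow> real \<Rightarrow> (rvec \<Rightarrow> real) \<Rightarrow> bool" where
  "regularizer d H \<rho> \<longleftrightarrow> 0 \<le> H \<and>
    (\<exists>r :: nat \<Rightarrow> real \<Rightarrow> real.
      (\<forall>\<theta>\<in>Rspace d. \<rho> \<theta> = (\<Sum>j<d. r j (\<theta> j))) \<and>
      (\<forall>j<d.
        r j 0 = 0 \<and> (\<forall>t. r j t = r j (- t)) \<and>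
        mono_on {0..} (r j) \<and>
        isCont (r j) 0 \<and>
        (\<forall>x>0. r j differentiable (at x)) \<and>
        (\<forall>x>0. \<forall>x'>0. \<bar>deriv (r j) x - deriv (r j) x'\<bar> \<le> H * \<bar>x - x'\<bar>)))"

definition loss :: "nat \<Rightarrow> nat \<Rightarrow> rmat \<Rightarrow> rvec \<Rightarrow> (rvec \<Rightarrow> real) \<Rightarrow> real \<Rightarrow> rvec \<Rightarrow> real" where
  "loss n d X y \<rho> lam \<theta> = 1 / real n * (vdist n y (mat_app n d X \<theta>))\<^sup>2 + lam * \<rho> \<theta>"

definition prediction_error :: "nat \<Rightarrow> nat \<Rightarrow> rmat \<Rightarrow> rvec \<Rightarrow> rvec \<Rightarrow> real" where
  "prediction_error n d X \<theta> \<theta>' = 1 / real n * (vdist n (mat_app n d X \<theta>) (mat_app n d X \<theta>'))\<^sup>2"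

definition local_minimum :: "nat \<Rightarrow> (rvec \<Rightarrow> real) \<Rightarrow> rvec \<Rightarrow> bool" where
  "local_minimum d f x \<longleftrightarrow> x \<in> Rspace d \<and>
    (\<exists>r>0. \<forall>z\<in>Rspace d. vdist d z x < r \<longrightarrow> f x \<le> f z)"

definition ball_minimizers :: "nat \<Rightarrow> (rvec \<Rightarrow> real) \<Rightarrow> real \<Rightarrow> rvec \<Rightarrow> rvec set" where
  "ball_minimizers d f \<eta> x = {z. is_arg_min f (\<lambda>z. z \<in> Rspace d \<and> vdist d z x \<le> \<eta>) z}"

definition closest_minimizers :: "nat \<Rightarrow> (rvec \<Rightarrow> real) \<Rightarrow> real \<Rightarrow> rvec \<Rightarrow> rvec set" where
  "closest_minimizers d f \<eta> x =
     {z. is_arg_min (\<lambda>z. vdist d z x) (\<lambda>z. z \<in> ball_minimizers d f \<eta> x) z}"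

text \<open>
  Randomized resolution of ties: a real random number \<open>s\<close> is turned into an element \<open>pick s S\<close> of
  the set \<open>S\<close> of candidates.
\<close>

definition tie_rule :: "(real \<Rightarrow> rvec set \<Rightarrow> rvec) \<Rightarrow> bool" where
  "tie_rule pick \<longleftrightarrow> (\<forall>s S. S \<noteq> {} \<longrightarrow> pick s S \<in> S)"

text \<open>
  The iterates \<open>\<theta>\<^sup>t\<close> of local descent on \<open>f\<close>; \<open>u t\<close> is the random number used for the ties of step
  \<open>t\<close>. The sequence is continued after termination, but only the part up to termination enters
  \<open>descent_output\<close>.
\<close>

primrec descent :: "nat \<Rightarrow> (rvec \<Rightarrow> real) \<Rightarrow> real \<Rightarrow> (real \<Rightarrow> rvec set \<Rightarrow> rvec) \<Rightarrow>
    (nat \<Rightarrow> real) \<Rightarrow> rvec \<Rightarrow> nat \<Rightarrow> rvec" where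
  "descent d f \<eta> pick u \<theta>0 0 = \<theta>0"
| "descent d f \<eta> pick u \<theta>0 (Suc t) =
     pick (u t) (closest_minimizers d f \<eta> (descent d f \<eta> pick u \<theta>0 t))"

definition stops_at :: "nat \<Rightarrow> (rvec \<Rightarrow> real) \<Rightarrow> real \<Rightarrow> (real \<Rightarrow> rvec set \<Rightarrow> rvec) \<Rightarrow>
    (nat \<Rightarrow> real) \<Rightarrow> rvec \<Rightarrow> nat \<Rightarrow> bool" where
  "stops_at d f \<eta> pick u \<theta>0 t \<longleftrightarrow>
     (\<exists>z \<in> ball_minimizers d f \<eta> (descent d f \<eta> pick u \<theta>0 t).
        vdist d z (descent d f \<eta> pick u \<theta>0 t) < \<eta>)"

definition descent_output :: "nat \<Rightarrow> (rvec \<Rightarrow> real) \<Rightarrow> real \<Rightarrow> (real \<Rightarrow> rvec set \<Rightarrow> rvec) \<Rightarrow>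
    (nat \<Rightarrow> real) \<Rightarrow> rvec \<Rightarrow> rvec" where
  "descent_output d f \<eta> pick u \<theta>0 =
     descent d f \<eta> pick u \<theta>0 (Suc (LEAST t. stops_at d f \<eta> pick u \<theta>0 t))"

text \<open>
  The stepsize may depend on the regularization weight \<open>lam\<close>; for \<open>lam * H = 0\<close> the bound
  \<open>B / (lam * H)\<close> is read as infinite and hence absent.
\<close>

definition admissible_stepsize :: "nat \<Rightarrow> real \<Rightarrow> real \<Rightarrow> (real \<Rightarrow> real) \<Rightarrow> bool" where
  "admissible_stepsize n \<sigma> H \<eta> \<longleftrightarrow>
     (let B = \<sigma> / (4 * sqrt (real n)) in
       \<forall>lam\<ge>0. 0 < \<eta> lam \<and> \<eta> lam \<le> B \<and> (lam * H \<noteq> 0 \<longrightarrow> \<eta> lam \<le> B / (lam * H)))"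

text \<open>
  The law \<open>N(0, s\<^sup>2)\<close>, including the degenerate case \<open>s = 0\<close>, in which \<^const>\<open>normal_density\<close> would
  not give a probability measure.
\<close>

definition gaussian :: "real \<Rightarrow> real measure" where
  "gaussian s = (if s = 0 then return borel 0
                 else density lborel (\<lambda>x. ennreal (normal_density 0 s x)))"

definition gaussian_vec :: "nat \<Rightarrow> real \<Rightarrow> rvec measure" where
  "gaussian_vec m s = PiM {..<m} (\<lambda>_. gaussian s)"

definition observation :: "nat \<Rightarrow> nat \<Rightarrow> rmat \<Rightarrow> rvec \<Rightarrow> rvec \<Rightarrow> rvec" where
  "observation n d X \<theta>s w = (\<lambda>i\<in>{..<n}. mat_app n d X \<theta>s i + w i)"

text \<open>
  The expectation, over the independent noise \<open>w\<close>, initialization \<open>\<theta>0\<close> and tie-breaking numbers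
  \<open>u\<close> with law \<open>U\<close>, of the prediction error for the best \<open>lam \<ge> 0\<close>. Here \<open>u lam t\<close> is the random
  number used in step \<open>t\<close> of the run with weight \<open>lam\<close>. The integrand is an infimum over an
  uncountable set and need not be measurable; in that case \<^const>\<open>nn_integral\<close> is the lower
  integral, so that a lower bound on it is the strongest reading.
\<close>

definition expected_best_error :: "nat \<Rightarrow> nat \<Rightarrow> rmat \<Rightarrow> (rvec \<Rightarrow> real) \<Rightarrow> (real \<Rightarrow> real) \<Rightarrow>
    (real \<Rightarrow> rvec set \<Rightarrow> rvec) \<Rightarrow> (real \<Rightarrow> nat \<Rightarrow> real) measure \<Rightarrow> real \<Rightarrow> real \<Rightarrow> rvec \<Rightarrow> ennreal" where
  "expected_best_error n d X \<rho> \<eta> pick U \<sigma> \<gamma> \<theta>s =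
     (\<integral>\<^sup>+ (w, \<theta>0, u).
        (INF lam\<in>{0..}. ennreal (prediction_error n d X
           (descent_output d (loss n d X (observation n d X \<theta>s w) \<rho> lam) (\<eta> lam) pick (u lam) \<theta>0)
           \<theta>s))
      \<partial>(gaussian_vec n \<sigma> \<Otimes>\<^sub>M (gaussian_vec d \<gamma> \<Otimes>\<^sub>M U)))"

end

theory Submission
  imports Defs
begin

text \<open>
  Write \<open>e = \<sigma> / sqrt n\<close> and \<open>R = min R\<^sub>0 \<sigma>\<close>, where \<open>R\<^sub>0\<close> is the given radius. The design consists of
  \<open>n div 2\<close> diagonal blocks \<open>sqrt n * ((cs, -cs), (sn, sn))\<close> with \<open>cs\<^sup>2 + sn\<^sup>2 = 1\<close> and
  \<open>sn\<^sup>2 = e / (4 R)\<close>, padded with zeros. On a pure-noise block with large noise in the first row, either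
  the fit follows the noise, at a cost of order \<open>e\<^sup>2\<close>, or \<open>lam\<close> times the slope of the penalty exceeds
  \<open>4 e\<close> somewhere on \<open>(0, e / 4]\<close>. In the block with the steepest penalty on this interval, a choice
  that does not depend on \<open>lam\<close>, place a signal of \<open>\<ell>\<^sub>1\<close>-norm \<open>R\<close> along \<open>(1, 1)\<close>, the direction that
  \<open>X\<close> shrinks by \<open>sn\<close>. If one noise block is penalized steeply, then so is this block, and the steep part of
  the penalty is a barrier which a descent with small steps, started from nonpositive coordinates, cannot
  cross: the first coordinate stays below \<open>e / 4\<close>, and the error is of order \<open>sn\<^sup>2 R\<^sup>2 = e R / 4\<close>.
  Otherwise all noise blocks with large noise follow it, and their costs add up to order
  \<open>n e\<^sup>2 = \<sigma>\<^sup>2 \<ge> e R\<close>.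
\<close>

section \<open>The Euclidean distance on \<open>Rspace\<close>\<close>

lemma vdist_self [simp]: "vdist m x x = 0"
  by (simp add: vdist_def L2_set_def)

lemma abs_coord_le_vdist:
  assumes "j < m"
  shows "\<bar>z j - x j\<bar> \<le> vdist m z x"
proof -
  have "(z j - x j)\<^sup>2 \<le> (\<Sum>i<m. (z i - x i)\<^sup>2)"
    by (rule member_le_sum) (use assms in auto)
  thus ?thesis
    unfolding vdist_def L2_set_def using real_sqrt_le_mono real_sqrt_abs by fastforce
qed

lemma vdist_upd_le:
  assumes "\<bar>a - x j\<bar> \<le> \<bar>z j - x j\<bar>"
  shows "vdist m (z(j := a)) x \<le> vdist m z x"
  unfolding vdist_def L2_set_def using assms
  by (auto intro!: real_sqrt_le_mono sum_mono simp: abs_le_square_iff)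

lemma vdist_upd_less:
  assumes "j < m" "\<bar>a - x j\<bar> < \<bar>z j - x j\<bar>"
  shows "vdist m (z(j := a)) x < vdist m z x"
proof -
  have "(\<Sum>i<m. ((z(j := a)) i - x i)\<^sup>2) < (\<Sum>i<m. (z i - x i)\<^sup>2)"
  proof (rule sum_strict_mono_ex1)
    have "(a - x j)\<^sup>2 < (z j - x j)\<^sup>2"
      using assms(2) by (meson abs_le_square_iff linorder_not_less)
    then show "\<exists>i\<in>{..<m}. ((z(j := a)) i - x i)\<^sup>2 < (z i - x i)\<^sup>2"
      using assms(1) by auto
  next
    show "\<forall>i\<in>{..<m}. ((z(j := a)) i - x i)\<^sup>2 \<le> (z i - x i)\<^sup>2"
      using assms(2) by (auto simp: abs_le_square_iff[symmetric])
  qed auto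
  thus ?thesis unfolding vdist_def L2_set_def by simp
qed

lemma vdist_upd_self:
  assumes "j < m"
  shows "vdist m (x(j := a)) x = \<bar>a - x j\<bar>"
proof -
  have "(\<Sum>i<m. ((x(j := a)) i - x i)\<^sup>2) = (\<Sum>i\<in>{j}. ((x(j := a)) i - x i)\<^sup>2)"
    by (rule sum.mono_neutral_right) (use assms in auto)
  thus ?thesis unfolding vdist_def L2_set_def by simp
qed

lemma vdist_triangle: "vdist m x z \<le> vdist m x y + vdist m y z"
proof -
  have "vdist m x z = L2_set (\<lambda>i. (x i - y i) + (y i - z i)) {..<m}"
    by (simp add: vdist_def)
  also have "\<dots> \<le> vdist m x y + vdist m y z"
    unfolding vdist_def by (rule L2_set_triangle_ineq)
  finally show ?thesis .
qed

lemma vdist_sq: "(vdist m x z)\<^sup>2 = (\<Sum>i<m. (x i - z i)\<^sup>2)"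
  by (simp add: vdist_def L2_set_def sum_nonneg)

lemma Rspace_upd: "\<theta> \<in> Rspace m \<Longrightarrow> j < m \<Longrightarrow> \<theta>(j := a) \<in> Rspace m"
  by (auto simp: Rspace_def PiE_def extensional_def)

section \<open>Continuity of the distance and compactness of balls\<close>

lemma continuous_on_vdist: "continuous_on UNIV (\<lambda>z. vdist m z x)"
  unfolding vdist_def L2_set_def by (intro continuous_intros) auto

text \<open>Tychonoff: an extensional function is a point of the product over all indices, with
  \<open>{undefined}\<close> as the factor outside \<open>{..<m}\<close>.\<close>

lemma compact_Rspace_box: "compact ({..<m} \<rightarrow>\<^sub>E {a..b} :: (nat \<Rightarrow> real) set)"
proof -
  have "({..<m} \<rightarrow>\<^sub>E {a..b}) = PiE UNIV (\<lambda>i. if i < m then {a..b} else {undefined})"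
    by (auto simp: PiE_def Pi_def extensional_def split: if_splits)
  moreover have "compactin (product_topology (\<lambda>_. euclidean) UNIV)
      (PiE UNIV (\<lambda>i. if i < m then {a..b} else {undefined :: real}))"
    unfolding compactin_PiE by auto
  ultimately show ?thesis
    by (simp add: euclidean_product_topology)
qed

lemma compact_vdist_cball: "compact {z \<in> Rspace m. vdist m z x \<le> r}"
proof -
  \<comment> \<open>Inserting 0 keeps \<open>Min\<close> and \<open>Max\<close> meaningful when
    \<open>m = 0\<close>.\<close>
  define a where "a = Min (insert 0 ((\<lambda>i. x i - r) ` {..<m}))"
  define b where "b = Max (insert 0 ((\<lambda>i. x i + r) ` {..<m}))"
  have "{z \<in> Rspace m. vdist m z x \<le> r} = ({..<m} \<rightarrow>\<^sub>E {a..b}) \<inter> {z. vdist m z x \<le> r}"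
  proof -
    have "a \<le> z i \<and> z i \<le> b" if "vdist m z x \<le> r" "i < m" for z i
    proof -
      have "\<bar>z i - x i\<bar> \<le> r" using abs_coord_le_vdist[OF that(2), of z x] that(1) by linarith
      moreover have "a \<le> x i - r" unfolding a_def using that by (intro Min_le) auto
      moreover have "x i + r \<le> b" unfolding b_def using that by (intro Max_ge) auto
      ultimately show ?thesis by linarith
    qed
    thus ?thesis by (auto simp: Rspace_def PiE_def Pi_def)
  qed
  moreover have "closed {z. vdist m z x \<le> r}"
    by (intro closed_Collect_le continuous_on_vdist continuous_intros)
  ultimately show ?thesis
    using compact_Rspace_box compact_Int_closed by metis
qed

section \<open>Local descent on a continuous function\<close>

lemma ball_minimizers_iff:
  "z \<in> ball_minimizers d f \<eta> x \<longleftrightarrow> z \<in> Rspace d \<and> vdist d z x \<le> \<eta> \<and>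
     (\<forall>y\<in>Rspace d. vdist d y x \<le> \<eta> \<longrightarrow> f z \<le> f y)"
  by (auto simp: ball_minimizers_def is_arg_min_linorder)

lemma closest_minimizers_iff:
  "z \<in> closest_minimizers d f \<eta> x \<longleftrightarrow> z \<in> ball_minimizers d f \<eta> x \<and>
     (\<forall>y\<in>ball_minimizers d f \<eta> x. vdist d z x \<le> vdist d y x)"
  by (auto simp: closest_minimizers_def is_arg_min_linorder)

text \<open>The minimizers over the compact ball form a nonempty compact set, on which the distance
  to \<open>x\<close> attains its minimum. As \<open>tie_rule\<close> constrains \<open>pick\<close>
  only on nonempty sets, control of the iterates rests on this.\<close>

lemma closest_minimizers_nonempty:
  assumes f: "continuous_on (Rspace d) f" and x: "x \<in> Rspace d" and \<eta>: "0 < \<eta>"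
  shows "closest_minimizers d f \<eta> x \<noteq> {}"
proof -
  define S where "S = {z \<in> Rspace d. vdist d z x \<le> \<eta>}"
  have cS: "compact S" unfolding S_def by (rule compact_vdist_cball)
  have cf: "continuous_on S f" using f by (rule continuous_on_subset) (auto simp: S_def)
  have "x \<in> S" using x \<eta> by (simp add: S_def)
  then obtain z where z: "z \<in> S" "\<forall>y\<in>S. f z \<le> f y"
    using continuous_attains_inf[OF cS _ cf] by blast
  have M: "ball_minimizers d f \<eta> x = {y \<in> S. f y \<in> {f z}}"
    using z by (force simp: ball_minimizers_iff S_def intro: antisym)
  have "closedin (top_of_set S) {y \<in> S. f y \<in> {f z}}"
    using continuous_closedin_preimage_constant[OF cf, of "f z"] by simp
  hence "compact (ball_minimizers d f \<eta> x)"
    unfolding M using cS closedin_compact by blast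
  moreover have "ball_minimizers d f \<eta> x \<noteq> {}" using z by (auto simp: M)
  moreover have "continuous_on (ball_minimizers d f \<eta> x) (\<lambda>y. vdist d y x)"
    using continuous_on_vdist continuous_on_subset by blast
  ultimately obtain y where "y \<in> ball_minimizers d f \<eta> x"
    "\<forall>w\<in>ball_minimizers d f \<eta> x. vdist d y x \<le> vdist d w x"
    using continuous_attains_inf by blast
  hence "y \<in> closest_minimizers d f \<eta> x" by (simp add: closest_minimizers_iff)
  thus ?thesis by blast
qed

text \<open>By compactness a subsequence converges, and two late members of it lie within
  \<open>\<eta> / 2\<close> of the limit.\<close>

lemma infinite_sequence_close_pair:
  assumes "\<And>t. x t \<in> {..<m} \<rightarrow>\<^sub>E {a..b :: real}" and \<eta>: "0 < \<eta>"
  obtains s t :: nat where "s < t" "vdist m (x t) (x s) < \<eta>"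
proof -
  obtain l r where r: "strict_mono (r :: nat \<Rightarrow> nat)" "(x \<circ> r) \<longlonglongrightarrow> l"
    using compact_imp_seq_compact[OF compact_Rspace_box[of m a b]] assms(1)
    by (meson seq_compactE)
  have "continuous_on UNIV (\<lambda>z. vdist m z l)" by (rule continuous_on_vdist)
  then have "(\<lambda>k. vdist m ((x \<circ> r) k) l) \<longlonglongrightarrow> vdist m l l"
    by (rule continuous_on_tendsto_compose[OF _ r(2)]) auto
  then have "\<forall>\<^sub>F k in sequentially. vdist m (x (r k)) l < \<eta> / 2"
    using \<eta> by (intro order_tendstoD(2)[where y = "vdist m l l"]) auto
  then obtain N where N: "\<And>k. k \<ge> N \<Longrightarrow> vdist m (x (r k)) l < \<eta> / 2"
    by (auto simp: eventually_sequentially)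
  have sym: "vdist m l (x (r N)) = vdist m (x (r N)) l"
    by (simp add: vdist_def L2_set_def power2_commute)
  show thesis
  proof (rule that)
    show "r N < r (Suc N)" using r(1) by (simp add: strict_mono_def)
    have "vdist m (x (r (Suc N))) (x (r N)) \<le> vdist m (x (r (Suc N))) l + vdist m l (x (r N))"
      by (rule vdist_triangle)
    also have "\<dots> < \<eta>" using N[of N] N[of "Suc N"] sym by simp
    finally show "vdist m (x (r (Suc N))) (x (r N)) < \<eta>" .
  qed
qed

section \<open>Runs of local descent: monotonicity, termination, output\<close>

locale local_descent =
  fixes d :: nat and f :: "rvec \<Rightarrow> real" and \<eta> :: real
    and pick :: "real \<Rightarrow> rvec set \<Rightarrow> rvec" and u :: "nat \<Rightarrow> real" and \<theta>0 :: rvec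
  assumes cont: "continuous_on (Rspace d) f" and \<eta>_pos: "0 < \<eta>"
    and pick: "tie_rule pick" and init: "\<theta>0 \<in> Rspace d"
begin

abbreviation iter :: "nat \<Rightarrow> rvec" where
  "iter \<equiv> descent d f \<eta> pick u \<theta>0"

abbreviation outcome :: rvec where
  "outcome \<equiv> descent_output d f \<eta> pick u \<theta>0"

lemma iter_Suc_closest_Rspace:
  "iter t \<in> Rspace d \<and> iter (Suc t) \<in> closest_minimizers d f \<eta> (iter t)"
proof (induction t)
  case 0
  show ?case
    using pick init closest_minimizers_nonempty[OF cont init \<eta>_pos] by (simp add: tie_rule_def)
next
  case (Suc t)
  hence R: "iter (Suc t) \<in> Rspace d" by (simp add: closest_minimizers_iff ball_minimizers_iff)
  thus ?case
    using pick closest_minimizers_nonempty[OF cont R \<eta>_pos] by (simp add: tie_rule_def)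
qed

lemma iter_Rspace: "iter t \<in> Rspace d"
  and iter_Suc_closest: "iter (Suc t) \<in> closest_minimizers d f \<eta> (iter t)"
  using iter_Suc_closest_Rspace by auto

lemma iter_Suc_minimizer: "iter (Suc t) \<in> ball_minimizers d f \<eta> (iter t)"
  using iter_Suc_closest[of t] by (simp add: closest_minimizers_iff)

lemma iter_Suc_min:
  "z \<in> Rspace d \<Longrightarrow> vdist d z (iter t) \<le> \<eta> \<Longrightarrow> f (iter (Suc t)) \<le> f z"
  using iter_Suc_minimizer[of t] by (auto simp: ball_minimizers_iff)

lemma f_iter_antimono: "s \<le> t \<Longrightarrow> f (iter t) \<le> f (iter s)"
proof (induction t rule: dec_induct)
  case (step t)
  have "f (iter (Suc t)) \<le> f (iter t)"
    using iter_Rspace \<eta>_pos by (intro iter_Suc_min) auto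
  with step show ?case by linarith
qed simp

text \<open>
  Two iterates of a bounded run are closer than \<open>\<eta>\<close>, and the later one is then an interior
  minimizer for the ball around the earlier one.
\<close>

lemma bounded_descent_stops:
  assumes "\<And>t j. j < d \<Longrightarrow> \<bar>iter t j\<bar> \<le> K"
  shows "\<exists>T. stops_at d f \<eta> pick u \<theta>0 T"
proof -
  have "iter t \<in> {..<d} \<rightarrow>\<^sub>E {-K..K}" for t
    using assms[of _ t] iter_Rspace[of t] by (auto simp: Rspace_def PiE_def Pi_def abs_le_iff minus_le_iff)
  then obtain s t where st: "s < t" "vdist d (iter t) (iter s) < \<eta>"
    using infinite_sequence_close_pair \<eta>_pos by metis
  have "f (iter t) \<le> f (iter (Suc s))" using st(1) by (intro f_iter_antimono) simp
  hence "iter t \<in> ball_minimizers d f \<eta> (iter s)"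
    using iter_Suc_minimizer[of s] st(2) iter_Rspace[of t] by (force simp: ball_minimizers_iff)
  thus ?thesis using st(2) unfolding stops_at_def by blast
qed

text \<open>If some minimizer is interior, then so is the closest one. A small ball around it fits
  into the step ball, over which it minimizes \<open>f\<close>.\<close>

lemma outcome_local_minimum:
  assumes "stops_at d f \<eta> pick u \<theta>0 T"
  shows "local_minimum d f outcome"
proof -
  define L where "L = (LEAST t. stops_at d f \<eta> pick u \<theta>0 t)"
  have "stops_at d f \<eta> pick u \<theta>0 L" unfolding L_def using assms by (rule LeastI)
  then obtain z where z: "z \<in> ball_minimizers d f \<eta> (iter L)" "vdist d z (iter L) < \<eta>"
    by (auto simp: stops_at_def)
  have close: "vdist d (iter (Suc L)) (iter L) < \<eta>"
    using iter_Suc_closest[of L] z unfolding closest_minimizers_iff by fastforce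
  have "f (iter (Suc L)) \<le> f y"
    if "y \<in> Rspace d" "vdist d y (iter (Suc L)) < \<eta> - vdist d (iter (Suc L)) (iter L)" for y
    using vdist_triangle[of d y "iter L" "iter (Suc L)"] that by (intro iter_Suc_min) auto
  thus ?thesis
    using close iter_Rspace[of "Suc L"] unfolding local_minimum_def descent_output_def L_def[symmetric]
    by (metis diff_gt_0_iff_gt)
qed

lemma outcome_invariant:
  assumes "\<And>t. P (iter t)"
  shows "P outcome"
  unfolding descent_output_def by (rule assms)

end

section \<open>Univariate penalties\<close>

definition penalty :: "real \<Rightarrow> (real \<Rightarrow> real) \<Rightarrow> bool" where
  "penalty H r \<longleftrightarrow> r 0 = 0 \<and> (\<forall>t. r t = r (- t)) \<and> mono_on {0..} r \<and> isCont r 0 \<and>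
     (\<forall>x>0. r differentiable (at x)) \<and>
     (\<forall>x>0. \<forall>x'>0. \<bar>deriv r x - deriv r x'\<bar> \<le> H * \<bar>x - x'\<bar>)"

lemma regularizer_iff:
  "regularizer d H \<rho> \<longleftrightarrow> 0 \<le> H \<and>
    (\<exists>r. (\<forall>\<theta>\<in>Rspace d. \<rho> \<theta> = (\<Sum>j<d. r j (\<theta> j))) \<and> (\<forall>j<d. penalty H (r j)))"
  by (simp add: regularizer_def penalty_def)

lemma penalty_mono_abs:
  assumes "penalty H r" "\<bar>s\<bar> \<le> \<bar>t\<bar>"
  shows "r s \<le> r t"
proof -
  have "r \<bar>s\<bar> \<le> r \<bar>t\<bar>"
    using assms by (auto simp: penalty_def intro: mono_onD)
  moreover have "r \<bar>z\<bar> = r z" for z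
    using assms(1) unfolding penalty_def abs_if by metis
  ultimately show ?thesis by metis
qed

lemma penalty_nonneg: "penalty H r \<Longrightarrow> 0 \<le> r t"
  using penalty_mono_abs[of H r 0 t] by (simp add: penalty_def)

lemma penalty_isCont:
  assumes "penalty H r"
  shows "isCont r x"
proof -
  have pos: "isCont r x" if "x > 0" for x
    using assms that by (auto simp: penalty_def intro: differentiable_imp_continuous_within)
  show ?thesis
  proof (cases "x < 0")
    case True
    have "isCont (\<lambda>t. r (- t)) x"
      using pos[of "- x"] True by (intro isCont_o2[of x uminus r]) auto
    moreover have "(\<lambda>t. r (- t)) = r" using assms by (auto simp: penalty_def)
    ultimately show ?thesis by simp
  next
    case False
    thus ?thesis using pos[of x] assms by (cases "x = 0") (auto simp: penalty_def)
  qed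
qed

lemma penalty_mvt:
  assumes "penalty H r" "0 \<le> a" "a < b"
  obtains x where "a < x" "x < b" "r b - r a = (b - a) * deriv r x"
proof -
  have "r differentiable (at x)" if "a < x" for x
    using assms that by (auto simp: penalty_def)
  moreover have "continuous_on {a..b} r"
    using penalty_isCont[OF assms(1)] by (simp add: continuous_at_imp_continuous_on)
  ultimately obtain l z where "a < z" "z < b" "DERIV r z :> l" "r b - r a = (b - a) * l"
    using MVT[OF assms(3)] by metis
  thus ?thesis using that DERIV_imp_deriv by metis
qed

lemma penalty_deriv_lipschitz:
  "penalty H r \<Longrightarrow> 0 < x \<Longrightarrow> 0 < x' \<Longrightarrow> \<bar>deriv r x - deriv r x'\<bar> \<le> H * \<bar>x - x'\<bar>"
  by (simp add: penalty_def)

text \<open>The Lipschitz condition carries the slope at the right end \<open>\<tau>\<close> over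
  the whole interval, down to its open end 0. This makes the suprema in
  \<open>exists_steepest\<close> finite.\<close>

lemma bdd_above_penalty_deriv:
  assumes "penalty H r" "0 \<le> H"
  shows "bdd_above (deriv r ` {0<..\<tau>})"
proof (rule bdd_aboveI2)
  fix x assume x: "x \<in> {0<..\<tau>}"
  hence "\<bar>deriv r x - deriv r \<tau>\<bar> \<le> H * \<bar>x - \<tau>\<bar>"
    using penalty_deriv_lipschitz[OF assms(1), of x \<tau>] by auto
  also have "\<dots> \<le> H * \<tau>" using x assms(2) by (intro mult_left_mono) auto
  finally show "deriv r x \<le> deriv r \<tau> + H * \<tau>" by linarith
qed

section \<open>The loss along a coordinate direction\<close>

text \<open>This is minus one half of the partial derivative of the quadratic part of the loss in
  coordinate \<open>j\<close>.\<close>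

definition correlation :: "nat \<Rightarrow> nat \<Rightarrow> rmat \<Rightarrow> rvec \<Rightarrow> rvec \<Rightarrow> nat \<Rightarrow> real" where
  "correlation n d X y \<theta> j = (\<Sum>i<n. X i j * (y i - mat_app n d X \<theta> i)) / real n"

lemma mat_app_upd:
  assumes "j < d" "i < n"
  shows "mat_app n d X (\<theta>(j := \<theta> j + s)) i = mat_app n d X \<theta> i + s * X i j"
proof -
  have "(\<Sum>l<d. X i l * (\<theta>(j := \<theta> j + s)) l) = (\<Sum>l<d. X i l * \<theta> l + (if l = j then s * X i j else 0))"
    by (rule sum.cong) (auto simp: algebra_simps)
  also have "\<dots> = (\<Sum>l<d. X i l * \<theta> l) + s * X i j"
    using assms by (simp add: sum.distrib)
  finally show ?thesis using assms by (simp add: mat_app_def)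
qed

lemma quadratic_loss_upd:
  assumes "j < d"
  shows "(vdist n y (mat_app n d X (\<theta>(j := \<theta> j + s))))\<^sup>2 / real n =
    (vdist n y (mat_app n d X \<theta>))\<^sup>2 / real n - 2 * s * correlation n d X y \<theta> j
      + s\<^sup>2 * ((\<Sum>i<n. (X i j)\<^sup>2) / real n)"
proof -
  define e where "e i = y i - mat_app n d X \<theta> i" for i
  have "(vdist n y (mat_app n d X (\<theta>(j := \<theta> j + s))))\<^sup>2 = (\<Sum>i<n. (e i - s * X i j)\<^sup>2)"
    unfolding vdist_sq e_def using assms by (intro sum.cong) (auto simp: mat_app_upd diff_diff_eq)
  also have "\<dots> = (\<Sum>i<n. (e i)\<^sup>2) - 2 * s * (\<Sum>i<n. X i j * e i) + s\<^sup>2 * (\<Sum>i<n. (X i j)\<^sup>2)"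
    by (simp add: power2_diff power_mult_distrib sum.distrib sum_subtractf sum_distrib_left algebra_simps)
  finally have "(vdist n y (mat_app n d X (\<theta>(j := \<theta> j + s))))\<^sup>2 =
      (vdist n y (mat_app n d X \<theta>))\<^sup>2 - 2 * s * (\<Sum>i<n. X i j * (y i - mat_app n d X \<theta> i))
        + s\<^sup>2 * (\<Sum>i<n. (X i j)\<^sup>2)"
    by (simp add: vdist_sq e_def)
  thus ?thesis
    by (simp only: correlation_def add_divide_distrib diff_divide_distrib times_divide_eq_right)
qed

section \<open>The loss with a separable penalty\<close>

locale separable_loss =
  fixes n d :: nat and X :: rmat and y :: rvec and \<rho> :: "rvec \<Rightarrow> real" and lam H :: real
    and r :: "nat \<Rightarrow> real \<Rightarrow> real"
  assumes \<rho>_sum: "\<And>\<theta>. \<theta> \<in> Rspace d \<Longrightarrow> \<rho> \<theta> = (\<Sum>j<d. r j (\<theta> j))"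
    and penalties: "\<And>j. j < d \<Longrightarrow> penalty H (r j)"
    and lam_nonneg: "0 \<le> lam" and H_nonneg: "0 \<le> H"
begin

abbreviation L :: "rvec \<Rightarrow> real" where
  "L \<equiv> loss n d X y \<rho> lam"

lemma loss_upd:
  assumes "\<theta> \<in> Rspace d" "j < d"
  shows "L (\<theta>(j := \<theta> j + s)) = L \<theta> - 2 * s * correlation n d X y \<theta> j
    + s\<^sup>2 * ((\<Sum>i<n. (X i j)\<^sup>2) / real n) + lam * (r j (\<theta> j + s) - r j (\<theta> j))"
proof -
  have "(\<Sum>l<d. r l ((\<theta>(j := \<theta> j + s)) l)) =
      (\<Sum>l<d. r l (\<theta> l) + (if l = j then r j (\<theta> j + s) - r j (\<theta> j) else 0))"
    by (rule sum.cong) auto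
  also have "\<dots> = (\<Sum>l<d. r l (\<theta> l)) + (r j (\<theta> j + s) - r j (\<theta> j))"
    using assms by (simp add: sum.distrib)
  finally have \<rho>: "\<rho> (\<theta>(j := \<theta> j + s)) = \<rho> \<theta> + (r j (\<theta> j + s) - r j (\<theta> j))"
    using assms by (simp add: \<rho>_sum Rspace_upd)
  have L: "L z = (vdist n y (mat_app n d X z))\<^sup>2 / real n + lam * \<rho> z" for z
    by (simp add: loss_def)
  show ?thesis
    unfolding L quadratic_loss_upd[OF assms(2)] \<rho> by (simp add: distrib_left)
qed

lemma loss_continuous: "continuous_on (Rspace d) L"
proof -
  have "continuous_on (Rspace d) (\<lambda>\<theta>. 1 / real n * (\<Sum>i<n. (y i - (\<Sum>j<d. X i j * \<theta> j))\<^sup>2)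
      + lam * (\<Sum>j<d. r j (\<theta> j)))"
  proof (intro continuous_intros)
    fix j assume "j \<in> {..<d}"
    hence "continuous_on UNIV (r j)"
      using penalty_isCont[OF penalties] by (simp add: continuous_at_imp_continuous_on)
    then show "continuous_on (Rspace d) (\<lambda>\<theta>. r j (\<theta> j))"
      by (rule continuous_on_compose2)
        (auto intro: continuous_on_subset[OF continuous_on_product_coordinates])
  qed (auto intro: continuous_on_subset[OF continuous_on_product_coordinates])
  moreover have "L \<theta> = 1 / real n * (\<Sum>i<n. (y i - (\<Sum>j<d. X i j * \<theta> j))\<^sup>2)
      + lam * (\<Sum>j<d. r j (\<theta> j))"
    if "\<theta> \<in> Rspace d" for \<theta>
    using that unfolding loss_def vdist_sq by (simp add: \<rho>_sum mat_app_def)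
  ultimately show ?thesis by (simp cong: continuous_on_cong)
qed

text \<open>The penalty is nonnegative. Since the loss decreases along a run, this bound keeps all
  fitted values bounded.\<close>

lemma residual_le_loss:
  assumes "\<theta> \<in> Rspace d" "i < n"
  shows "(y i - mat_app n d X \<theta> i)\<^sup>2 \<le> real n * L \<theta>"
proof -
  have "0 \<le> lam * \<rho> \<theta>"
    using assms lam_nonneg penalty_nonneg[OF penalties]
    by (auto simp: \<rho>_sum intro!: mult_nonneg_nonneg sum_nonneg)
  moreover have "(y i - mat_app n d X \<theta> i)\<^sup>2 \<le> (vdist n y (mat_app n d X \<theta>))\<^sup>2"
    unfolding vdist_sq by (rule member_le_sum) (use assms in auto)
  moreover have "real n * L \<theta> = (vdist n y (mat_app n d X \<theta>))\<^sup>2 + real n * (lam * \<rho> \<theta>)"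
    using assms by (simp add: loss_def distrib_left)
  ultimately show ?thesis
    by (smt (verit) mult_nonneg_nonneg of_nat_0_le_iff)
qed

text \<open>A column of \<open>X\<close> that vanishes leaves the penalty alone to decide; it cannot push outwards.\<close>

lemma closest_minimizer_zero_column:
  assumes "z \<in> closest_minimizers d L \<eta> x" "j < d" "\<And>i. i < n \<Longrightarrow> X i j = 0"
  shows "\<bar>z j\<bar> \<le> \<bar>x j\<bar>"
proof (rule ccontr)
  assume "\<not> \<bar>z j\<bar> \<le> \<bar>x j\<bar>"
  hence gt: "\<bar>x j\<bar> < \<bar>z j\<bar>" by simp
  \<comment> \<open>Undoing the move in coordinate \<open>j\<close> does not raise the loss and
    comes strictly closer to \<open>x\<close>, against the choice of a closest minimizer.\<close>
  let ?z' = "z(j := x j)"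
  have z: "z \<in> Rspace d" "vdist d z x \<le> \<eta>"
    and m: "\<And>w. w \<in> Rspace d \<Longrightarrow> vdist d w x \<le> \<eta> \<Longrightarrow> L z \<le> L w"
    and cl: "\<And>w. w \<in> ball_minimizers d L \<eta> x \<Longrightarrow> vdist d z x \<le> vdist d w x"
    using assms(1) by (auto simp: closest_minimizers_iff ball_minimizers_iff)
  have lt: "vdist d ?z' x < vdist d z x"
    using gt assms(2) by (intro vdist_upd_less) auto
  have "L ?z' = L z + lam * (r j (x j) - r j (z j))"
    using loss_upd[OF z(1) assms(2), of "x j - z j"] assms(3) by (simp add: correlation_def)
  moreover have "r j (x j) \<le> r j (z j)"
    using penalty_mono_abs[OF penalties[OF assms(2)]] gt by simp
  ultimately have "L ?z' \<le> L z"
    using lam_nonneg by (simp add: mult_nonneg_nonpos)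
  hence "?z' \<in> ball_minimizers d L \<eta> x"
    using m lt z Rspace_upd[OF z(1) assms(2)] by (force simp: ball_minimizers_iff)
  with cl[OF this] lt show False by simp
qed

end

section \<open>The block design\<close>

text \<open>\<open>i div 2\<close> is the block of index \<open>i\<close>. Row \<open>2 * b\<close>
  sees the difference of the two coordinates of block \<open>b\<close>, row \<open>2 * b + 1\<close>
  their sum, damped by \<open>sn\<close>. The factor \<open>sqrt n\<close> normalizes the
  columns.\<close>

definition block_matrix :: "nat \<Rightarrow> real \<Rightarrow> real \<Rightarrow> rmat" where
  "block_matrix n cs sn i j =
     (if i div 2 = j div 2 \<and> i div 2 < n div 2
      then sqrt (real n) * (if odd i then sn else if even j then cs else - cs) else 0)"

lemma sum_block:
  fixes g :: "nat \<Rightarrow> real"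
  assumes "b < m div 2" "\<And>i. i < m \<Longrightarrow> i div 2 \<noteq> b \<Longrightarrow> g i = 0"
  shows "(\<Sum>i<m. g i) = g (2 * b) + g (2 * b + 1)"
proof -
  have "(\<Sum>i<m. g i) = (\<Sum>i\<in>{2 * b, 2 * b + 1}. g i)"
  proof (rule sum.mono_neutral_right)
    show "\<forall>i\<in>{..<m} - {2 * b, 2 * b + 1}. g i = 0"
    proof
      fix i assume i: "i \<in> {..<m} - {2 * b, 2 * b + 1}"
      hence "i div 2 \<noteq> b" by auto
      with i show "g i = 0" using assms(2) by simp
    qed
  qed (use assms(1) in auto)
  thus ?thesis by simp
qed

lemma sum_blocks:
  fixes g :: "nat \<Rightarrow> real"
  assumes "\<And>i. i < n \<Longrightarrow> n div 2 \<le> i div 2 \<Longrightarrow> g i = 0"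
  shows "(\<Sum>i<n. g i) = (\<Sum>b<n div 2. g (2 * b) + g (2 * b + 1))"
proof -
  have pairs: "(\<Sum>i<2 * k. g i) = (\<Sum>b<k. g (2 * b) + g (2 * b + 1))" for k
    by (induction k) (auto simp: add.assoc)
  have "(\<Sum>i<n. g i) = (\<Sum>i<2 * (n div 2). g i)"
  proof (rule sum.mono_neutral_right)
    show "\<forall>i\<in>{..<n} - {..<2 * (n div 2)}. g i = 0"
    proof
      fix i assume i: "i \<in> {..<n} - {..<2 * (n div 2)}"
      hence "n div 2 \<le> i div 2" by auto
      with i show "g i = 0" using assms by simp
    qed
  qed auto
  also have "\<dots> = (\<Sum>b<n div 2. g (2 * b) + g (2 * b + 1))"
    using pairs .
  finally show ?thesis .
qed

lemma block_matrix_column: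
  assumes "j div 2 < n div 2"
  shows "(\<Sum>i<n. (block_matrix n cs sn i j)\<^sup>2) = real n * (cs\<^sup>2 + sn\<^sup>2)"
proof -
  have "(\<Sum>i<n. (block_matrix n cs sn i j)\<^sup>2) = (block_matrix n cs sn (2 * (j div 2)) j)\<^sup>2
      + (block_matrix n cs sn (2 * (j div 2) + 1) j)\<^sup>2"
    by (rule sum_block) (use assms in \<open>auto simp: block_matrix_def\<close>)
  thus ?thesis using assms
    by (auto simp: block_matrix_def power_mult_distrib distrib_left)
qed

lemma block_matrix_zero_column: "n div 2 \<le> j div 2 \<Longrightarrow> block_matrix n cs sn i j = 0"
  by (simp add: block_matrix_def)

lemma block_matrix_normalized:
  assumes "cs\<^sup>2 + sn\<^sup>2 = 1"
  shows "column_normalized n d (block_matrix n cs sn)"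
  unfolding column_normalized_def
proof (intro allI impI)
  fix j
  show "L2_set (\<lambda>i. block_matrix n cs sn i j) {..<n} / sqrt (real n) \<le> 1"
  proof (cases "j div 2 < n div 2")
    case True
    thus ?thesis using assms by (simp add: L2_set_def block_matrix_column)
  next
    case False
    thus ?thesis by (simp add: L2_set_def block_matrix_zero_column)
  qed
qed

lemma block_matrix_app:
  assumes "b < n div 2" "n \<le> d"
  shows "mat_app n d (block_matrix n cs sn) \<theta> (2 * b) =
           sqrt (real n) * (cs * (\<theta> (2 * b) - \<theta> (2 * b + 1)))"
    and "mat_app n d (block_matrix n cs sn) \<theta> (2 * b + 1) =
           sqrt (real n) * (sn * (\<theta> (2 * b) + \<theta> (2 * b + 1)))"
proof -
  have b: "b < d div 2" using assms by auto
  have "(\<Sum>j<d. block_matrix n cs sn i j * \<theta> j) =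
      block_matrix n cs sn i (2 * b) * \<theta> (2 * b) + block_matrix n cs sn i (2 * b + 1) * \<theta> (2 * b + 1)"
    if "i div 2 = b" for i
    by (rule sum_block[OF b]) (use that in \<open>auto simp: block_matrix_def\<close>)
  moreover have "2 * b + 1 < n" using assms by auto
  ultimately show "mat_app n d (block_matrix n cs sn) \<theta> (2 * b) =
           sqrt (real n) * (cs * (\<theta> (2 * b) - \<theta> (2 * b + 1)))"
    and "mat_app n d (block_matrix n cs sn) \<theta> (2 * b + 1) =
           sqrt (real n) * (sn * (\<theta> (2 * b) + \<theta> (2 * b + 1)))"
    using assms(1) by (auto simp: mat_app_def block_matrix_def algebra_simps)
qed

lemma block_matrix_app_zero:
  "i < n \<Longrightarrow> n div 2 \<le> i div 2 \<Longrightarrow> mat_app n d (block_matrix n cs sn) \<theta> i = 0"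
  by (simp add: mat_app_def block_matrix_def)

text \<open>\<open>h\<close> comes from the difference row and \<open>k\<close> from the sum row.
  The two columns of a block are opposite in the former and equal in the latter, whence the
  signs.\<close>

lemma block_matrix_correlation:
  fixes cs sn :: real and y \<theta> :: rvec
  assumes "b < n div 2" "n \<le> d"
  defines "h \<equiv> cs * (y (2 * b) / sqrt n - cs * (\<theta> (2 * b) - \<theta> (2 * b + 1)))"
    and "k \<equiv> sn * (y (2 * b + 1) / sqrt n - sn * (\<theta> (2 * b) + \<theta> (2 * b + 1)))"
  shows "correlation n d (block_matrix n cs sn) y \<theta> (2 * b) = h + k"
    and "correlation n d (block_matrix n cs sn) y \<theta> (2 * b + 1) = k - h"
proof -
  have root: "sqrt n * a / real n = a / sqrt n" for a
    using sqrt_divide_self_eq[of "real n"] by (simp add: divide_inverse mult.commute mult.left_commute)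
  have n: "sqrt (real n) > 0" using assms(1) by auto
  define e where "e i = y i - mat_app n d (block_matrix n cs sn) \<theta> i" for i
  have S: "(\<Sum>i<n. block_matrix n cs sn i j * e i) =
      block_matrix n cs sn (2 * b) j * e (2 * b) + block_matrix n cs sn (2 * b + 1) j * e (2 * b + 1)"
    if "j div 2 = b" for j
    by (rule sum_block[OF assms(1)]) (use that in \<open>auto simp: block_matrix_def\<close>)
  have hk: "cs * e (2 * b) / sqrt n = h" "sn * e (2 * b + 1) / sqrt n = k"
    unfolding e_def h_def k_def block_matrix_app[OF assms(1,2)] using n
    by (simp_all add: diff_divide_distrib right_diff_distrib)
  have "correlation n d (block_matrix n cs sn) y \<theta> (2 * b) = (cs * e (2 * b) + sn * e (2 * b + 1)) / sqrt n"
    unfolding correlation_def e_def[symmetric] root[symmetric]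
    using S[of "2 * b"] assms(1) by (simp add: block_matrix_def algebra_simps)
  thus "correlation n d (block_matrix n cs sn) y \<theta> (2 * b) = h + k"
    using hk by (simp add: add_divide_distrib)
  have "correlation n d (block_matrix n cs sn) y \<theta> (2 * b + 1) = (sn * e (2 * b + 1) - cs * e (2 * b)) / sqrt n"
    unfolding correlation_def e_def[symmetric] root[symmetric]
    using S[of "2 * b + 1"] assms(1) by (simp add: block_matrix_def algebra_simps)
  thus "correlation n d (block_matrix n cs sn) y \<theta> (2 * b + 1) = k - h"
    using hk by (simp add: diff_divide_distrib)
qed

text \<open>Blocks occupy disjoint rows, and the squared scaling of the design cancels
  \<open>1 / n\<close>.\<close>

lemma block_prediction_error:
  assumes "n \<le> d"
  shows "prediction_error n d (block_matrix n cs sn) \<theta> \<theta>' =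
    (\<Sum>b<n div 2. (cs * ((\<theta> (2 * b) - \<theta>' (2 * b)) - (\<theta> (2 * b + 1) - \<theta>' (2 * b + 1))))\<^sup>2
      + (sn * ((\<theta> (2 * b) - \<theta>' (2 * b)) + (\<theta> (2 * b + 1) - \<theta>' (2 * b + 1))))\<^sup>2)"
proof (cases "n = 0")
  case False
  let ?A = "mat_app n d (block_matrix n cs sn)"
  have "(?A \<theta> (2 * b) - ?A \<theta>' (2 * b))\<^sup>2 + (?A \<theta> (2 * b + 1) - ?A \<theta>' (2 * b + 1))\<^sup>2 =
     real n * ((cs * ((\<theta> (2 * b) - \<theta>' (2 * b)) - (\<theta> (2 * b + 1) - \<theta>' (2 * b + 1))))\<^sup>2
      + (sn * ((\<theta> (2 * b) - \<theta>' (2 * b)) + (\<theta> (2 * b + 1) - \<theta>' (2 * b + 1))))\<^sup>2)"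
    if "b < n div 2" for b
  proof -
    have "?A \<theta> (2 * b) - ?A \<theta>' (2 * b) =
        sqrt n * (cs * ((\<theta> (2 * b) - \<theta>' (2 * b)) - (\<theta> (2 * b + 1) - \<theta>' (2 * b + 1))))"
      "?A \<theta> (2 * b + 1) - ?A \<theta>' (2 * b + 1) =
        sqrt n * (sn * ((\<theta> (2 * b) - \<theta>' (2 * b)) + (\<theta> (2 * b + 1) - \<theta>' (2 * b + 1))))"
      unfolding block_matrix_app[OF that assms] by (simp_all add: algebra_simps)
    thus ?thesis by (simp only: power_mult_distrib) (simp add: distrib_left)
  qed
  moreover have "(vdist n (?A \<theta>) (?A \<theta>'))\<^sup>2 =
      (\<Sum>b<n div 2. (?A \<theta> (2 * b) - ?A \<theta>' (2 * b))\<^sup>2 + (?A \<theta> (2 * b + 1) - ?A \<theta>' (2 * b + 1))\<^sup>2)"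
    unfolding vdist_sq by (rule sum_blocks) (simp add: block_matrix_app_zero)
  ultimately show ?thesis
    using False by (simp add: prediction_error_def sum_distrib_left[symmetric])
qed (simp add: prediction_error_def)

section \<open>The loss for the block design\<close>

locale block_loss = separable_loss n d "block_matrix n cs sn" y \<rho> lam H r
  for n d cs sn y \<rho> lam H r +
  assumes trig: "cs\<^sup>2 + sn\<^sup>2 = 1" and cs_pos: "0 < cs" and sn_pos: "0 < sn"
    and n_pos: "0 < n" and n_le_d: "n \<le> d"
begin

abbreviation grad :: "rvec \<Rightarrow> nat \<Rightarrow> real" where
  "grad \<equiv> correlation n d (block_matrix n cs sn) y"

lemma block_index: "b < n div 2 \<Longrightarrow> 2 * b + 1 < d" "b < n div 2 \<Longrightarrow> 2 * b < d"
  using n_le_d by auto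

lemma loss_upd_block:
  assumes "\<theta> \<in> Rspace d" "j div 2 < n div 2"
  shows "L (\<theta>(j := \<theta> j + s)) = L \<theta> - 2 * s * grad \<theta> j + s\<^sup>2 + lam * (r j (\<theta> j + s) - r j (\<theta> j))"
proof -
  have "j < d" using assms(2) n_le_d by linarith
  thus ?thesis
    using loss_upd[OF assms(1), of j s] block_matrix_column[OF assms(2)] trig n_pos by simp
qed

text \<open>It suffices that the run is bounded. In a block, bounded fitted values bound the
  difference and the sum of the pair, as \<open>cs\<close> and \<open>sn\<close> are positive; in a
  zero column the closest choice never moves outwards.\<close>

lemma descent_stops:
  assumes "0 < \<eta>" "tie_rule pick" "\<theta>0 \<in> Rspace d"
  shows "\<exists>T. stops_at d L \<eta> pick u \<theta>0 T"
proof -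
  interpret local_descent d L \<eta> pick u \<theta>0
    using assms loss_continuous by unfold_locales
  \<comment> \<open>\<open>M\<close> bounds every fitted value along the run; \<open>a\<close> and
    \<open>c\<close> are the resulting bounds on the difference and the sum within a block.\<close>
  define M where "M = sqrt (real n * L \<theta>0) + (\<Sum>i<n. \<bar>y i\<bar>)"
  define a where "a = M / (sqrt n * cs)"
  define c where "c = M / (sqrt n * sn)"
  have app: "\<bar>mat_app n d (block_matrix n cs sn) (iter t) i\<bar> \<le> M" if "i < n" for i t
  proof -
    have "(y i - mat_app n d (block_matrix n cs sn) (iter t) i)\<^sup>2 \<le> real n * L (iter t)"
      by (rule residual_le_loss[OF iter_Rspace that])
    also have "\<dots> \<le> real n * L \<theta>0"
      using f_iter_antimono[of 0 t] by (intro mult_left_mono) auto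
    finally have "\<bar>y i - mat_app n d (block_matrix n cs sn) (iter t) i\<bar> \<le> sqrt (real n * L \<theta>0)"
      using real_le_rsqrt by (metis power2_abs)
    moreover have "\<bar>y i\<bar> \<le> (\<Sum>i<n. \<bar>y i\<bar>)"
      by (rule member_le_sum) (use that in auto)
    ultimately show ?thesis unfolding M_def by linarith
  qed
  have block: "\<bar>iter t (2 * b)\<bar> \<le> a + c \<and> \<bar>iter t (2 * b + 1)\<bar> \<le> a + c" if b: "b < n div 2" for b t
  proof -
    have "sqrt n * (cs * \<bar>iter t (2 * b) - iter t (2 * b + 1)\<bar>) \<le> M"
      using app[of "2 * b" t] b cs_pos unfolding block_matrix_app[OF b n_le_d] by (simp add: abs_mult)
    hence "\<bar>iter t (2 * b) - iter t (2 * b + 1)\<bar> \<le> a"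
      unfolding a_def using cs_pos n_pos by (simp add: field_simps)
    moreover have "sqrt n * (sn * \<bar>iter t (2 * b) + iter t (2 * b + 1)\<bar>) \<le> M"
      using app[of "2 * b + 1" t] b sn_pos unfolding block_matrix_app[OF b n_le_d] by (simp add: abs_mult)
    hence "\<bar>iter t (2 * b) + iter t (2 * b + 1)\<bar> \<le> c"
      unfolding c_def using sn_pos n_pos by (simp add: field_simps)
    ultimately show ?thesis by linarith
  qed
  have free: "\<bar>iter t j\<bar> \<le> \<bar>\<theta>0 j\<bar>" if "n div 2 \<le> j div 2" "j < d" for j t
  proof (induction t)
    case (Suc t)
    have "\<bar>iter (Suc t) j\<bar> \<le> \<bar>iter t j\<bar>"
      by (rule closest_minimizer_zero_column[OF iter_Suc_closest])
        (use that block_matrix_zero_column in auto)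
    with Suc show ?case by linarith
  qed simp
  have "\<bar>iter t j\<bar> \<le> a + c + (\<Sum>j<d. \<bar>\<theta>0 j\<bar>)" if "j < d" for t j
  proof -
    have \<theta>0: "\<bar>\<theta>0 j\<bar> \<le> (\<Sum>j<d. \<bar>\<theta>0 j\<bar>)" by (rule member_le_sum) (use that in auto)
    have "0 \<le> a + c"
      using app[of 0 0] n_pos cs_pos sn_pos unfolding a_def c_def by (intro add_nonneg_nonneg) auto
    moreover have "j = 2 * (j div 2) \<or> j = 2 * (j div 2) + 1" by linarith
    ultimately show ?thesis
      using block[of "j div 2" t] free[of j t] \<theta>0 that by (smt (verit) linorder_not_less)
  qed
  thus ?thesis by (rule bounded_descent_stops)
qed

end

section \<open>Noise blocks and the trap\<close>

text \<open>The two equal entries cancel in the difference row of block \<open>b0\<close>, so the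
  signal reaches the data only through the factor \<open>sn\<close>.\<close>

definition spike :: "nat \<Rightarrow> nat \<Rightarrow> real \<Rightarrow> rvec" where
  "spike d b0 R = (\<lambda>j\<in>{..<d}. if j div 2 = b0 then R / 2 else 0)"

lemma spike_support: "{j. j < d \<and> spike d b0 R j \<noteq> 0} \<subseteq> {2 * b0, 2 * b0 + 1}"
  by (auto simp: spike_def split: if_splits)

lemma spike_in_B0: "2 \<le> k \<Longrightarrow> spike d b0 R \<in> B0 d k"
proof -
  have "card {j. j < d \<and> spike d b0 R j \<noteq> 0} \<le> card {2 * b0, 2 * b0 + 1}"
    by (rule card_mono[OF _ spike_support]) simp
  moreover assume "2 \<le> k"
  ultimately show ?thesis by (simp add: B0_def) (simp add: Rspace_def spike_def)
qed

lemma spike_in_B1: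
  assumes "b0 < d div 2" "0 \<le> R" "R \<le> R'"
  shows "spike d b0 R \<in> B1 d R'"
proof -
  have "(\<Sum>j<d. \<bar>spike d b0 R j\<bar>) = R"
    using assms by (subst sum_block[of b0]) (auto simp: spike_def)
  thus ?thesis using assms by (simp add: B1_def Rspace_def spike_def)
qed

text \<open>Both weights are at least \<open>sn\<close>. By the parallelogram identity the
  unweighted sum is at least half of \<open>(R - 2 * \<theta>1)\<^sup>2\<close>, and
  \<open>R - 2 * \<theta>1\<close> is at least \<open>R / 2\<close>.\<close>

lemma trapped_error:
  fixes \<theta>1 \<theta>2 cs sn R :: real
  assumes "0 \<le> sn" "sn \<le> cs" "0 \<le> R" "\<theta>1 \<le> R / 4"
  shows "sn\<^sup>2 * R\<^sup>2 / 8 \<le> (cs * (\<theta>1 - \<theta>2))\<^sup>2 + (sn * (\<theta>1 + \<theta>2 - R))\<^sup>2"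
proof -
  have "(R / 2)\<^sup>2 \<le> (R - 2 * \<theta>1)\<^sup>2" using assms by (intro power_mono) auto
  moreover have "(\<theta>1 - \<theta>2)\<^sup>2 + (\<theta>1 + \<theta>2 - R)\<^sup>2 = (R - 2 * \<theta>1)\<^sup>2 / 2 + (R - 2 * \<theta>2)\<^sup>2 / 2"
    by (simp add: power2_eq_square field_simps)
  ultimately have "R\<^sup>2 / 8 \<le> (\<theta>1 - \<theta>2)\<^sup>2 + (\<theta>1 + \<theta>2 - R)\<^sup>2"
    by (simp add: power_divide) (smt (verit) zero_le_power2)
  hence "sn\<^sup>2 * (R\<^sup>2 / 8) \<le> sn\<^sup>2 * ((\<theta>1 - \<theta>2)\<^sup>2 + (\<theta>1 + \<theta>2 - R)\<^sup>2)"
    by (intro mult_left_mono) auto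
  also have "\<dots> \<le> cs\<^sup>2 * (\<theta>1 - \<theta>2)\<^sup>2 + sn\<^sup>2 * (\<theta>1 + \<theta>2 - R)\<^sup>2"
    using assms by (simp add: distrib_left mult_right_mono power_mono)
  finally show ?thesis by (simp add: power_mult_distrib)
qed

context block_loss
begin

text \<open>Increments replace derivatives because the penalty may have a kink at the
  origin.\<close>

lemma local_minimum_first_order:
  assumes "local_minimum d L \<theta>" "j div 2 < n div 2"
  obtains \<delta> where "0 < \<delta>"
    "\<And>s. \<bar>s\<bar> < \<delta> \<Longrightarrow> 2 * s * grad \<theta> j \<le> s\<^sup>2 + lam * (r j (\<theta> j + s) - r j (\<theta> j))"
proof -
  obtain \<delta> where \<theta>: "\<theta> \<in> Rspace d" and \<delta>: "0 < \<delta>"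
    "\<And>z. z \<in> Rspace d \<Longrightarrow> vdist d z \<theta> < \<delta> \<Longrightarrow> L \<theta> \<le> L z"
    using assms(1) by (auto simp: local_minimum_def)
  have j: "j < d" using assms(2) n_le_d by linarith
  show thesis
  proof (rule that[OF \<delta>(1)])
    fix s :: real assume "\<bar>s\<bar> < \<delta>"
    hence "L \<theta> \<le> L (\<theta>(j := \<theta> j + s))"
      using j \<theta> by (intro \<delta>(2) Rspace_upd) (auto simp: vdist_upd_self)
    thus "2 * s * grad \<theta> j \<le> s\<^sup>2 + lam * (r j (\<theta> j + s) - r j (\<theta> j))"
      unfolding loss_upd_block[OF \<theta> assms(2)] by linarith
  qed
qed

text \<open>
  The two partial derivatives of the quadratic part have opposite signs, so the two coordinates
  have opposite signs as well and are both bounded by their difference. If the block contributes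
  little to the error, it is therefore the slope of the penalty near the origin that balances the
  large noise.
\<close>

lemma small_error_imp_steep:
  assumes min: "local_minimum d L \<theta>" and b: "b < n div 2" and e: "0 < e"
    and cs: "4 / 5 \<le> cs" and sn: "sn \<le> 1 / 2"
    and y: "4 * e \<le> y (2 * b) / sqrt n" "\<bar>y (2 * b + 1) / sqrt n\<bar> \<le> e"
    and small: "(cs * (\<theta> (2 * b) - \<theta> (2 * b + 1)))\<^sup>2 + (sn * (\<theta> (2 * b) + \<theta> (2 * b + 1)))\<^sup>2 < (e / 10)\<^sup>2"
  shows "\<exists>\<xi>\<in>{0<..e / 4}. 4 * e < lam * deriv (r (2 * b)) \<xi>"
proof -
  let ?p = "\<theta> (2 * b)" and ?q = "\<theta> (2 * b + 1)"
  have u1: "\<bar>cs * (?p - ?q)\<bar> < e / 10" and u2: "\<bar>sn * (?p + ?q)\<bar> < e / 10"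
    by (rule power_less_imp_less_base[where n = 2];
        use small e in \<open>simp; smt (verit) zero_le_power2\<close>)+
  define h where "h = cs * (y (2 * b) / sqrt n - cs * (?p - ?q))"
  define k where "k = sn * (y (2 * b + 1) / sqrt n - sn * (?p + ?q))"
  \<comment> \<open>In units of \<open>e\<close>, the residual of the difference row is at least 4 -
    1/10, so \<open>h\<close> is at least 3.12, while the absolute value of \<open>k\<close> is at
    most 0.55; this leaves more than 5/2.\<close>
  have "39 / 10 * e \<le> y (2 * b) / sqrt n - cs * (?p - ?q)" using u1 y(1) by linarith
  hence "4 / 5 * (39 / 10 * e) \<le> h"
    unfolding h_def using cs e by (intro mult_mono) auto
  moreover have "\<bar>y (2 * b + 1) / sqrt n - sn * (?p + ?q)\<bar> \<le> 11 / 10 * e" using u2 y(2) by linarith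
  hence "\<bar>k\<bar> \<le> 1 / 2 * (11 / 10 * e)"
    unfolding k_def abs_mult using sn sn_pos e by (intro mult_mono) auto
  ultimately have g: "5 / 2 * e < grad \<theta> (2 * b)" "grad \<theta> (2 * b + 1) < - (5 / 2 * e)"
    unfolding block_matrix_correlation[OF b n_le_d] h_def[symmetric] k_def[symmetric]
    using e by linarith+
  note pen = penalties[OF block_index(2)[OF b]] penalties[OF block_index(1)[OF b]]
  obtain \<delta>1 where \<delta>1: "0 < \<delta>1" "\<And>s. \<bar>s\<bar> < \<delta>1 \<Longrightarrow>
      2 * s * grad \<theta> (2 * b) \<le> s\<^sup>2 + lam * (r (2 * b) (?p + s) - r (2 * b) ?p)"
    using local_minimum_first_order[OF min, of "2 * b"] b by auto
  obtain \<delta>2 where \<delta>2: "0 < \<delta>2" "\<And>s. \<bar>s\<bar> < \<delta>2 \<Longrightarrow>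
      2 * s * grad \<theta> (2 * b + 1) \<le> s\<^sup>2 + lam * (r (2 * b + 1) (?q + s) - r (2 * b + 1) ?q)"
    using local_minimum_first_order[OF min, of "2 * b + 1"] b by auto
  \<comment> \<open>From a negative \<open>?p\<close>, a step towards the origin costs no penalty,
    and \<open>s \<le> e\<close> is too short for its square to offset the gradient. The sign of
    \<open>?q\<close> follows in the mirrored way.\<close>
  have p: "0 \<le> ?p"
  proof (rule ccontr)
    assume neg: "\<not> 0 \<le> ?p"
    define s where "s = min (\<delta>1 / 2) (min (- ?p) e)"
    have s: "0 < s" "s < \<delta>1" "s \<le> - ?p" "s \<le> e" unfolding s_def using \<delta>1(1) neg e by auto
    have "lam * (r (2 * b) (?p + s) - r (2 * b) ?p) \<le> 0"
      using lam_nonneg penalty_mono_abs[OF pen(1), of "?p + s" ?p] s by (simp add: mult_nonneg_nonpos)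
    moreover have "\<bar>s\<bar> < \<delta>1" using s by simp
    ultimately have "2 * s * grad \<theta> (2 * b) \<le> s\<^sup>2" using \<delta>1(2)[of s] by linarith
    hence "s * (2 * grad \<theta> (2 * b)) \<le> s * s" by (simp only: power2_eq_square mult_ac)
    hence "2 * grad \<theta> (2 * b) \<le> s" using s(1) by simp
    with g s e show False by linarith
  qed
  have q: "?q \<le> 0"
  proof (rule ccontr)
    assume pos: "\<not> ?q \<le> 0"
    define s where "s = min (\<delta>2 / 2) (min ?q e)"
    have s: "0 < s" "s < \<delta>2" "s \<le> ?q" "s \<le> e" unfolding s_def using \<delta>2(1) pos e by auto
    have "lam * (r (2 * b + 1) (?q - s) - r (2 * b + 1) ?q) \<le> 0"
      using lam_nonneg penalty_mono_abs[OF pen(2), of "?q - s" ?q] s by (simp add: mult_nonneg_nonpos)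
    hence "s * (- 2 * grad \<theta> (2 * b + 1)) \<le> s * s"
      using \<delta>2(2)[of "- s"] s by (simp add: power2_eq_square)
    hence "- 2 * grad \<theta> (2 * b + 1) \<le> s" using s(1) by (simp only: mult_le_cancel_left_pos)
    with g s e show False by linarith
  qed
  \<comment> \<open>Since \<open>?q \<le> 0\<close>, \<open>?p\<close> is at most the difference,
    which is at most 5/4 times \<open>e / 10\<close>.\<close>
  have "4 / 5 * ?p \<le> 4 / 5 * (?p - ?q)" using q by simp
  also have "\<dots> \<le> cs * (?p - ?q)" using cs p q by (intro mult_right_mono) auto
  also have "\<dots> \<le> e / 10" using u1 by simp
  finally have p_le: "?p \<le> e / 8" by simp
  \<comment> \<open>A forward step of at most \<open>e / 8\<close> stays within
    \<open>e / 4\<close>. The mean slope must balance twice the gradient up to \<open>s\<close>,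
    that is, more than \<open>5 * e - e / 8\<close>.\<close>
  define s where "s = min (\<delta>1 / 2) (e / 8)"
  have s: "0 < s" "s < \<delta>1" "s \<le> e / 8" unfolding s_def using \<delta>1(1) e by auto
  obtain \<xi> where \<xi>: "?p < \<xi>" "\<xi> < ?p + s" "r (2 * b) (?p + s) - r (2 * b) ?p = s * deriv (r (2 * b)) \<xi>"
    using penalty_mvt[OF pen(1) p, of "?p + s"] s(1) by auto
  have "s * (2 * grad \<theta> (2 * b)) \<le> s * (s + lam * deriv (r (2 * b)) \<xi>)"
    using \<delta>1(2)[of s] s \<xi>(3) by (simp add: power2_eq_square algebra_simps)
  hence "2 * grad \<theta> (2 * b) \<le> s + lam * deriv (r (2 * b)) \<xi>" using s(1) by (simp only: mult_le_cancel_left_pos)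
  hence "4 * e < lam * deriv (r (2 * b)) \<xi>" using g(1) s(3) e by linarith
  thus ?thesis using \<xi> p p_le s by (intro bexI[of _ \<xi>]) auto
qed

text \<open>Moving a coordinate back towards \<open>x j\<close> stays in the ball. This one-sided
  condition holds even when \<open>z\<close> lies on the boundary, where the full first-order
  condition may fail.\<close>

lemma ball_minimizer_backward:
  assumes z: "z \<in> ball_minimizers d L \<eta> x" and j: "j div 2 < n div 2" and s: "0 \<le> s" "s \<le> z j - x j"
  shows "0 \<le> 2 * s * grad z j + s\<^sup>2 + lam * (r j (z j - s) - r j (z j))"
proof -
  have R: "z \<in> Rspace d" and d: "vdist d z x \<le> \<eta>"
    and min: "\<And>w. w \<in> Rspace d \<Longrightarrow> vdist d w x \<le> \<eta> \<Longrightarrow> L z \<le> L w"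
    using z by (auto simp: ball_minimizers_iff)
  have "j < d" using j n_le_d by linarith
  moreover have "vdist d (z(j := z j + - s)) x \<le> vdist d z x"
    using s by (intro vdist_upd_le) auto
  ultimately have "L z \<le> L (z(j := z j + - s))" using d by (intro min Rspace_upd R) auto
  thus ?thesis unfolding loss_upd_block[OF R j] by simp
qed

text \<open>One step passes \<open>\<xi>\<close> by at most \<open>\<eta>\<close>, a distance over
  which the Lipschitz condition preserves most of the slope. The gradient cannot pay for that slope
  while the partner coordinate is bounded, so the two bounds are carried along jointly.\<close>

lemma descent_trapped:
  assumes \<eta>: "0 < \<eta>" "\<eta> \<le> e / 4" "lam * H * \<eta> \<le> e / 4" and pick: "tie_rule pick"
    and \<theta>0: "\<theta>0 \<in> Rspace d" "\<theta>0 (2 * b) \<le> 0" "\<theta>0 (2 * b + 1) \<le> 0"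
    and b: "b < n div 2" and e: "0 < e" and sn: "sn \<le> cs"
    and \<xi>: "\<xi> \<in> {0<..e / 4}" and steep: "4 * e < lam * deriv (r (2 * b)) \<xi>"
    and y: "cs * (y (2 * b) / sqrt n) + sn * (y (2 * b + 1) / sqrt n) \<le> 5 / 8 * e"
      "sn * (y (2 * b + 1) / sqrt n) - cs * (y (2 * b) / sqrt n) \<le> 5 / 8 * e"
  shows "descent d L \<eta> pick u \<theta>0 t (2 * b) \<le> \<xi> \<and> descent d L \<eta> pick u \<theta>0 t (2 * b + 1) \<le> 9 / 8 * e"
proof -
  interpret local_descent d L \<eta> pick u \<theta>0
    using \<eta> pick \<theta>0 loss_continuous by unfold_locales
  \<comment> \<open>\<open>c\<close> couples the two coordinates. As it lies between 0 and 1, an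
    upper bound on one coordinate limits the upward pull on the other.\<close>
  define c where "c = cs\<^sup>2 - sn\<^sup>2"
  have c: "0 \<le> c" "c \<le> 1"
    unfolding c_def using trig sn sn_pos power_mono[of sn cs 2] zero_le_power2[of sn] by (simp_all, linarith)
  have grad: "grad z (2 * b) = cs * (y (2 * b) / sqrt n) + sn * (y (2 * b + 1) / sqrt n)
        - z (2 * b) + c * z (2 * b + 1)"
    "grad z (2 * b + 1) = sn * (y (2 * b + 1) / sqrt n) - cs * (y (2 * b) / sqrt n)
        - z (2 * b + 1) + c * z (2 * b)" for z
  proof -
    have "sn\<^sup>2 = 1 - cs\<^sup>2" using trig by simp
    thus "grad z (2 * b) = cs * (y (2 * b) / sqrt n) + sn * (y (2 * b + 1) / sqrt n)
        - z (2 * b) + c * z (2 * b + 1)"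
      "grad z (2 * b + 1) = sn * (y (2 * b + 1) / sqrt n) - cs * (y (2 * b) / sqrt n)
        - z (2 * b + 1) + c * z (2 * b)"
      unfolding block_matrix_correlation[OF b n_le_d] c_def
      by (simp_all add: right_diff_distrib mult.assoc[symmetric] power2_eq_square[symmetric])
        (simp_all add: algebra_simps)
  qed
  note pen = penalties[OF block_index(2)[OF b]] penalties[OF block_index(1)[OF b]]
  show ?thesis
  proof (induction t)
    case 0
    thus ?case using \<theta>0 \<xi> e by simp
  next
    case (Suc t)
    define x where "x = iter t"
    define z where "z = iter (Suc t)"
    have IH: "x (2 * b) \<le> \<xi>" "x (2 * b + 1) \<le> 9 / 8 * e" using Suc by (simp_all add: x_def)
    have zmin: "z \<in> ball_minimizers d L \<eta> x" unfolding x_def z_def by (rule iter_Suc_minimizer)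
    have "\<bar>z (2 * b) - x (2 * b)\<bar> \<le> \<eta>"
      using abs_coord_le_vdist[OF block_index(2)[OF b], of z x] zmin by (simp add: ball_minimizers_iff)
    hence z1: "z (2 * b) \<le> \<xi> + \<eta>" using IH by linarith
    \<comment> \<open>Only the step length enters here: \<open>z (2 * b)\<close> is at most
      \<open>\<xi> + \<eta>\<close>, hence at most \<open>e / 2\<close>. The bound 9/8 is 5/8 from
      the data plus 1/2 from the coupling.\<close>
    have z2: "z (2 * b + 1) \<le> 9 / 8 * e"
    proof (rule ccontr)
      define s where "s = z (2 * b + 1) - 9 / 8 * e"
      assume "\<not> z (2 * b + 1) \<le> 9 / 8 * e"
      hence s: "0 < s" by (simp add: s_def)
      have "lam * (r (2 * b + 1) (z (2 * b + 1) - s) - r (2 * b + 1) (z (2 * b + 1))) \<le> 0"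
        using lam_nonneg s e penalty_mono_abs[OF pen(2), of "z (2 * b + 1) - s" "z (2 * b + 1)"]
        by (simp add: mult_nonneg_nonpos s_def)
      moreover have "0 \<le> 2 * s * grad z (2 * b + 1) + s\<^sup>2
          + lam * (r (2 * b + 1) (z (2 * b + 1) - s) - r (2 * b + 1) (z (2 * b + 1)))"
        using b s IH(2) by (intro ball_minimizer_backward[OF zmin]) (auto simp: s_def)
      ultimately have "0 \<le> s * (2 * grad z (2 * b + 1) + s)"
        by (simp add: power2_eq_square algebra_simps)
      hence "0 \<le> 2 * grad z (2 * b + 1) + s" using s by (simp add: zero_le_mult_iff)
      moreover have "c * z (2 * b) \<le> e / 2"
      proof -
        have "c * z (2 * b) \<le> c * (e / 2)" using z1 \<xi> \<eta>(2) c by (intro mult_left_mono) auto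
        also have "\<dots> \<le> 1 * (e / 2)" using c e by (intro mult_right_mono) auto
        finally show ?thesis by simp
      qed
      ultimately show False using s y(2) grad(2)[of z] unfolding s_def by linarith
    qed
    have "z (2 * b) \<le> \<xi>"
    proof (rule ccontr)
      define s where "s = z (2 * b) - \<xi>"
      assume "\<not> z (2 * b) \<le> \<xi>"
      hence s: "0 < s" and gt: "\<xi> < z (2 * b)" by (simp_all add: s_def)
      obtain x' where x': "\<xi> < x'" "x' < z (2 * b)"
          "r (2 * b) (z (2 * b)) - r (2 * b) \<xi> = s * deriv (r (2 * b)) x'"
        using penalty_mvt[OF pen(1) _ gt] \<xi> by (auto simp: s_def)
      \<comment> \<open>Between \<open>\<xi>\<close> and \<open>z (2 * b)\<close> the weighted slope
        drops by at most \<open>lam * H * \<eta>\<close>, so \<open>15 / 4 * e\<close>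
        survives.\<close>
      have "\<bar>deriv (r (2 * b)) x' - deriv (r (2 * b)) \<xi>\<bar> \<le> H * \<bar>x' - \<xi>\<bar>"
        using \<xi> x' by (intro penalty_deriv_lipschitz[OF pen(1)]) auto
      also have "\<dots> \<le> H * \<eta>" using x' z1 H_nonneg by (intro mult_left_mono) auto
      finally have "deriv (r (2 * b)) \<xi> - H * \<eta> \<le> deriv (r (2 * b)) x'" by linarith
      hence "lam * (deriv (r (2 * b)) \<xi> - H * \<eta>) \<le> lam * deriv (r (2 * b)) x'"
        using lam_nonneg by (rule mult_left_mono)
      hence slope: "15 / 4 * e < lam * deriv (r (2 * b)) x'"
        using steep \<eta>(3) by (simp add: right_diff_distrib mult.assoc)
      have "r (2 * b) (z (2 * b) - s) - r (2 * b) (z (2 * b)) = - (s * deriv (r (2 * b)) x')"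
        using x'(3) by (simp add: s_def)
      moreover have "0 \<le> 2 * s * grad z (2 * b) + s\<^sup>2
          + lam * (r (2 * b) (z (2 * b) - s) - r (2 * b) (z (2 * b)))"
        using b s IH(1) by (intro ball_minimizer_backward[OF zmin]) (auto simp: s_def)
      ultimately have "0 \<le> 2 * s * grad z (2 * b) + s\<^sup>2 + lam * (- (s * deriv (r (2 * b)) x'))"
        by (simp only:)
      hence "0 \<le> s * (2 * grad z (2 * b) + s - lam * deriv (r (2 * b)) x')"
        by (simp add: power2_eq_square algebra_simps)
      hence "0 \<le> 2 * grad z (2 * b) + s - lam * deriv (r (2 * b)) x'"
        using s by (simp add: zero_le_mult_iff)
      moreover have "c * z (2 * b + 1) \<le> 9 / 8 * e"
      proof -
        have "c * z (2 * b + 1) \<le> c * (9 / 8 * e)" using z2 c by (intro mult_left_mono) auto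
        also have "\<dots> \<le> 1 * (9 / 8 * e)" using c e by (intro mult_right_mono) auto
        finally show ?thesis by simp
      qed
      moreover have "0 < \<xi>" using \<xi> by simp
      \<comment> \<open>The upward pull \<open>2 * grad z (2 * b) + s\<close> is below 2 (5/8 + 9/8)
        = 7/2 in units of \<open>e\<close>, less than the slope 15/4.\<close>
      ultimately show False using slope y(1) z1 \<eta>(2) gt grad(1)[of z] unfolding s_def by linarith
    qed
    with z2 show ?case by (simp add: z_def)
  qed
qed

text \<open>Either every block of \<open>G\<close> pays \<open>e\<^sup>2 / 100\<close>, or some
  block pays less and is penalized steeply; \<open>steepest\<close> transfers this to block
  \<open>b0\<close>, where the run is trapped. The conditions on \<open>w\<close>,
  \<open>\<theta>0\<close> and \<open>G\<close> do not mention \<open>lam\<close>, which permits a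
  bound for all weights at once.\<close>

lemma outcome_error:
  assumes \<eta>: "0 < \<eta>" "\<eta> \<le> e / 4" "lam * H * \<eta> \<le> e / 4" and pick: "tie_rule pick"
    and \<theta>0: "\<theta>0 \<in> Rspace d" "\<theta>0 (2 * b0) \<le> 0" "\<theta>0 (2 * b0 + 1) \<le> 0"
    and b0: "b0 < n div 2" and e: "0 < e" "e \<le> R" and cs: "4 / 5 \<le> cs" and sn: "sn \<le> 1 / 2"
    and sn_R: "sn\<^sup>2 * R = e / 4"
    and steepest: "\<And>b \<xi>. b < n div 2 \<Longrightarrow> \<xi> \<in> {0<..e / 4} \<Longrightarrow> 4 * e < lam * deriv (r (2 * b)) \<xi> \<Longrightarrow>
      \<exists>\<xi>\<in>{0<..e / 4}. 4 * e < lam * deriv (r (2 * b0)) \<xi>"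
    and y: "y = observation n d (block_matrix n cs sn) (spike d b0 R) w"
    and w0: "\<bar>w (2 * b0)\<bar> \<le> e * sqrt n / 4" "\<bar>w (2 * b0 + 1)\<bar> \<le> e * sqrt n / 4"
    and G: "G \<subseteq> {..<n div 2} - {b0}"
    and w: "\<And>b. b \<in> G \<Longrightarrow> 4 * (e * sqrt n) \<le> w (2 * b)" "\<And>b. b \<in> G \<Longrightarrow> \<bar>w (2 * b + 1)\<bar> \<le> e * sqrt n"
  shows "min (real (card G) * (e\<^sup>2 / 100)) (e * R / 32) \<le>
    prediction_error n d (block_matrix n cs sn) (descent_output d L \<eta> pick u \<theta>0) (spike d b0 R)"
proof -
  interpret local_descent d L \<eta> pick u \<theta>0
    using \<eta> pick \<theta>0 loss_continuous by unfold_locales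
  let ?\<theta> = outcome and ?\<theta>s = "spike d b0 R"
  define E where "E b = (cs * ((?\<theta> (2 * b) - ?\<theta>s (2 * b)) - (?\<theta> (2 * b + 1) - ?\<theta>s (2 * b + 1))))\<^sup>2
      + (sn * ((?\<theta> (2 * b) - ?\<theta>s (2 * b)) + (?\<theta> (2 * b + 1) - ?\<theta>s (2 * b + 1))))\<^sup>2" for b
  have PE: "prediction_error n d (block_matrix n cs sn) ?\<theta> ?\<theta>s = (\<Sum>b<n div 2. E b)"
    unfolding E_def by (rule block_prediction_error[OF n_le_d])
  have E_nonneg: "0 \<le> E b" for b by (simp add: E_def)
  have spike: "?\<theta>s (2 * b) = (if b = b0 then R / 2 else 0)" "?\<theta>s (2 * b + 1) = (if b = b0 then R / 2 else 0)"
    if "b < n div 2" for b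
    using block_index[OF that] by (auto simp: spike_def)
  have root: "0 < sqrt (real n)" using n_pos by simp
  have y_eq: "y (2 * b) = w (2 * b)" "y (2 * b + 1) = (if b = b0 then sqrt n * (sn * R) else 0) + w (2 * b + 1)"
    if "b < n div 2" for b
  proof -
    have "2 * b + 1 < n" using that by linarith
    thus "y (2 * b) = w (2 * b)" "y (2 * b + 1) = (if b = b0 then sqrt n * (sn * R) else 0) + w (2 * b + 1)"
      using block_matrix_app[OF that n_le_d, of cs sn ?\<theta>s] spike[OF that]
      by (simp_all add: y observation_def)
  qed
  show ?thesis
  proof (cases "\<forall>b\<in>G. e\<^sup>2 / 100 \<le> E b")
    case True
    have "real (card G) * (e\<^sup>2 / 100) = (\<Sum>b\<in>G. e\<^sup>2 / 100)" by simp
    also have "\<dots> \<le> (\<Sum>b\<in>G. E b)" using True by (intro sum_mono) auto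
    also have "\<dots> \<le> (\<Sum>b<n div 2. E b)" using G E_nonneg by (intro sum_mono2) auto
    finally show ?thesis unfolding PE by linarith
  next
    case False
    then obtain b where b: "b \<in> G" "E b < e\<^sup>2 / 100" by force
    hence bm: "b < n div 2" "b \<noteq> b0" using G by auto
    obtain T where "stops_at d L \<eta> pick u \<theta>0 T"
      using descent_stops[OF \<eta>(1) pick \<theta>0(1)] by blast
    hence min: "local_minimum d L ?\<theta>" by (rule outcome_local_minimum)
    have "\<exists>\<xi>\<in>{0<..e / 4}. 4 * e < lam * deriv (r (2 * b)) \<xi>"
    proof (rule small_error_imp_steep[OF min bm(1) e(1) cs sn])
      show "4 * e \<le> y (2 * b) / sqrt (real n)" "\<bar>y (2 * b + 1) / sqrt (real n)\<bar> \<le> e"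
        unfolding y_eq[OF bm(1)] using w[OF b(1)] root bm(2) by (simp_all add: field_simps)
      show "(cs * (?\<theta> (2 * b) - ?\<theta> (2 * b + 1)))\<^sup>2 + (sn * (?\<theta> (2 * b) + ?\<theta> (2 * b + 1)))\<^sup>2 < (e / 10)\<^sup>2"
        using b(2) bm(2) unfolding E_def spike[OF bm(1)] by (simp add: power_divide)
    qed
    then obtain \<xi> where \<xi>: "\<xi> \<in> {0<..e / 4}" "4 * e < lam * deriv (r (2 * b0)) \<xi>"
      using steepest bm by blast
    \<comment> \<open>In block \<open>b0\<close> the signal contributes
      \<open>sn * (sn * R) = e / 4\<close> and the noise at most \<open>e / 4 + e / 8\<close>, in
      total the \<open>5 / 8 * e\<close> that the trap withstands.\<close>
    define A where "A = cs * (w (2 * b0) / sqrt n)"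
    define B where "B = sn * (w (2 * b0 + 1) / sqrt n)"
    have "cs\<^sup>2 \<le> 1\<^sup>2" using trig zero_le_power2[of sn] unfolding one_power2 by linarith
    hence "cs \<le> 1" by (rule power2_le_imp_le) simp
    hence A: "\<bar>A\<bar> \<le> 1 * (e / 4)"
      unfolding A_def abs_mult using w0 root cs_pos by (intro mult_mono) (auto simp: field_simps)
    have B: "\<bar>B\<bar> \<le> 1 / 2 * (e / 4)"
      unfolding B_def abs_mult using w0 root sn sn_pos by (intro mult_mono) (auto simp: field_simps)
    have yA: "cs * (y (2 * b0) / sqrt n) = A" unfolding A_def y_eq(1)[OF b0] ..
    have yB: "sn * (y (2 * b0 + 1) / sqrt n) = e / 4 + B"
      unfolding y_eq(2)[OF b0] sn_R[symmetric] B_def using root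
      by (simp add: add_divide_distrib distrib_left power2_eq_square)
    have y0: "cs * (y (2 * b0) / sqrt n) + sn * (y (2 * b0 + 1) / sqrt n) \<le> 5 / 8 * e"
      "sn * (y (2 * b0 + 1) / sqrt n) - cs * (y (2 * b0) / sqrt n) \<le> 5 / 8 * e"
      unfolding yA yB using A B by simp_all
    have "sn \<le> cs" using cs sn by linarith
    from descent_trapped[OF \<eta> pick \<theta>0 b0 e(1) this \<xi> y0]
    have "?\<theta> (2 * b0) \<le> \<xi>" by (intro outcome_invariant[of "\<lambda>z. z (2 * b0) \<le> \<xi>"]) blast
    \<comment> \<open>The barrier lies at or below \<open>e / 4 \<le> R / 4\<close>, half the height
      of the signal.\<close>
    hence "?\<theta> (2 * b0) \<le> R / 4" using \<xi> e by simp
    hence "sn\<^sup>2 * R\<^sup>2 / 8 \<le> (cs * (?\<theta> (2 * b0) - ?\<theta> (2 * b0 + 1)))\<^sup>2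
        + (sn * (?\<theta> (2 * b0) + ?\<theta> (2 * b0 + 1) - R))\<^sup>2"
      using e sn_pos \<open>sn \<le> cs\<close> by (intro trapped_error) auto
    also have "\<dots> = E b0" unfolding E_def spike[OF b0] by (simp add: algebra_simps)
    also have "\<dots> \<le> (\<Sum>b<n div 2. E b)" using b0 E_nonneg by (intro member_le_sum) auto
    also have "sn\<^sup>2 * R\<^sup>2 / 8 = e * R / 32"
    proof -
      have "sn\<^sup>2 * R\<^sup>2 = (sn\<^sup>2 * R) * R" by (simp only: power2_eq_square[of R] mult.assoc)
      thus ?thesis unfolding sn_R by (simp add: mult.commute)
    qed
    finally show ?thesis unfolding PE by linarith
  qed
qed

end

section \<open>Gaussian boxes\<close>

text \<open>Half of the standard normal density at 5: a lower bound for the normal probability of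
  any interval of length at least 1/2 inside [-5, 5], in units of the standard deviation.\<close>

definition interval_mass :: real where
  "interval_mass = exp (- 25 / 2) / (2 * sqrt (2 * pi))"

lemma interval_mass_pos: "0 < interval_mass"
  by (simp add: interval_mass_def)

lemma sets_gaussian [simp, measurable_cong]: "sets (gaussian s) = sets borel"
  by (simp add: gaussian_def)

lemma space_gaussian [simp]: "space (gaussian s) = UNIV"
  by (simp add: gaussian_def)

lemma prob_space_gaussian:
  assumes "0 \<le> s"
  shows "prob_space (gaussian s)"
proof (cases "s = 0")
  case True
  thus ?thesis by (simp add: gaussian_def prob_space_return)
next
  case False
  thus ?thesis using assms prob_space_normal_density[of s 0] by (simp add: gaussian_def)
qed

lemma gaussian_interval_ge:
  assumes s: "0 < s" and ab: "- 5 \<le> a" "a + 1 / 2 \<le> b" "b \<le> 5"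
  shows "ennreal interval_mass \<le> emeasure (gaussian s) {a * s..b * s}"
proof -
  define c where "c = exp (- 25 / 2) / (sqrt (2 * pi) * s)"
  have c: "0 \<le> c" using s by (simp add: c_def)
  have "interval_mass = c * (s / 2)"
    using s by (simp add: c_def interval_mass_def)
  also have "\<dots> \<le> c * (b * s - a * s)"
  proof -
    have "1 / 2 * s \<le> (b - a) * s" using s ab by (intro mult_right_mono) auto
    thus ?thesis using c by (intro mult_left_mono) (simp_all add: left_diff_distrib)
  qed
  finally have le: "ennreal interval_mass \<le> ennreal c * ennreal (b * s - a * s)"
    using c by (simp add: ennreal_mult'[symmetric] ennreal_leI)
  have "a * s \<le> b * s" using s ab by (intro mult_right_mono) auto
  hence "ennreal c * ennreal (b * s - a * s) = (\<integral>\<^sup>+x. ennreal c * indicator {a * s..b * s} x \<partial>lborel)"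
    by (subst nn_integral_cmult) auto
  also have "\<dots> \<le> (\<integral>\<^sup>+x. ennreal (normal_density 0 s x) * indicator {a * s..b * s} x \<partial>lborel)"
  proof (rule nn_integral_mono)
    fix x :: real
    have "c \<le> normal_density 0 s x" if "x \<in> {a * s..b * s}"
    proof -
      have "- 5 * s \<le> a * s" "b * s \<le> 5 * s"
        using s ab by (intro mult_right_mono; simp)+
      moreover have "a * s \<le> x" "x \<le> b * s" using that by auto
      ultimately have "\<bar>x\<bar> \<le> 5 * s" by linarith
      hence "x\<^sup>2 \<le> (5 * s)\<^sup>2" using s by (metis abs_le_square_iff abs_of_nonneg abs_ge_zero order_trans)
      hence "x\<^sup>2 / (2 * s\<^sup>2) \<le> 25 / 2" using s by (simp add: field_simps power2_eq_square)
      moreover have "sqrt (2 * pi * s\<^sup>2) = sqrt (2 * pi) * s" using s by (simp add: real_sqrt_mult)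
      ultimately show ?thesis
        unfolding normal_density_def c_def using s by (simp add: divide_right_mono)
    qed
    thus "ennreal c * indicator {a * s..b * s} x \<le> ennreal (normal_density 0 s x) * indicator {a * s..b * s} x"
      by (auto simp: indicator_def ennreal_leI)
  qed
  also have "\<dots> = emeasure (gaussian s) {a * s..b * s}"
    using s by (simp add: gaussian_def emeasure_density)
  finally show ?thesis using le by (rule order_trans[rotated])
qed

lemma gaussian_nonpos_ge:
  assumes "0 \<le> s"
  shows "ennreal interval_mass \<le> emeasure (gaussian s) {..0}"
proof (cases "s = 0")
  case True
  \<comment> \<open>Variance 1 serves to show that \<open>interval_mass\<close> is at most 1, which
    is the probability of \<open>{..0}\<close> under the point mass at 0.\<close>
  have "ennreal interval_mass \<le> emeasure (gaussian 1) {- 1 * 1..0 * 1}"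
    by (rule gaussian_interval_ge) auto
  also have "\<dots> \<le> 1"
    using prob_space_gaussian[of 1] by (simp add: prob_space.emeasure_le_1)
  finally show ?thesis using True by (simp add: gaussian_def)
next
  case False
  have "ennreal interval_mass \<le> emeasure (gaussian s) {- 1 * s..0 * s}"
    by (rule gaussian_interval_ge) (use assms False in auto)
  also have "\<dots> \<le> emeasure (gaussian s) {..0}" by (rule emeasure_mono) auto
  finally show ?thesis .
qed

lemma prob_space_gaussian_vec: "0 \<le> s \<Longrightarrow> prob_space (gaussian_vec m s)"
  unfolding gaussian_vec_def by (intro prob_space_PiM prob_space_gaussian)

definition rbox :: "nat \<Rightarrow> nat set \<Rightarrow> (nat \<Rightarrow> real set) \<Rightarrow> rvec set" where
  "rbox m F A = (\<Pi>\<^sub>E i\<in>{..<m}. if i \<in> F then A i else UNIV)"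

lemma rbox_sets:
  assumes "\<And>i. i \<in> F \<Longrightarrow> A i \<in> sets borel"
  shows "rbox m F A \<in> sets (gaussian_vec m s)"
  unfolding rbox_def gaussian_vec_def using assms by (intro sets_PiM_I_finite) auto

text \<open>By independence. The bound involves \<open>card F\<close> but not the dimension, as a
  universal constant demands.\<close>

lemma gaussian_vec_rbox_ge:
  assumes s: "0 \<le> s" and F: "F \<subseteq> {..<m}"
    and A: "\<And>i. i \<in> F \<Longrightarrow> A i \<in> sets borel" "\<And>i. i \<in> F \<Longrightarrow> q \<le> emeasure (gaussian s) (A i)"
  shows "q ^ card F \<le> emeasure (gaussian_vec m s) (rbox m F A)"
proof -
  interpret prob_space "gaussian s" using s by (rule prob_space_gaussian)
  interpret finite_product_sigma_finite "\<lambda>_. gaussian s" "{..<m}"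
    by unfold_locales auto
  have "q ^ card F = (\<Prod>i\<in>F. q)" by simp
  also have "\<dots> \<le> (\<Prod>i\<in>F. emeasure (gaussian s) (A i))" using A by (intro prod_mono_ennreal)
  also have "\<dots> = (\<Prod>i<m. emeasure (gaussian s) (if i \<in> F then A i else UNIV))"
    using F emeasure_space_1 by (intro prod.mono_neutral_cong_left) auto
  also have "\<dots> = emeasure (gaussian_vec m s) (rbox m F A)"
    unfolding gaussian_vec_def rbox_def using A by (subst measure_times) auto
  finally show ?thesis .
qed

section \<open>The lower bound\<close>

text \<open>Some block maximizes the supremum of the slope over the interval. A positive weight
  rescales all slopes alike, so the same block serves every \<open>lam\<close>; the signal has to be
  placed before \<open>lam\<close> is chosen. The supremum may not be attained, hence the strict
  inequalities.\<close>

lemma exists_steepest: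
  fixes m :: nat and \<tau> :: real
  assumes pen: "\<And>b. b < m \<Longrightarrow> penalty H (\<phi> b)" and H: "0 \<le> H" and m: "0 < m" and \<tau>: "0 < \<tau>"
  obtains b0 where "b0 < m"
    "\<And>b \<xi> lam a. \<lbrakk>b < m; \<xi> \<in> {0<..\<tau>}; 0 \<le> lam; 0 < a; a < lam * deriv (\<phi> b) \<xi>\<rbrakk> \<Longrightarrow>
       \<exists>\<xi>\<in>{0<..\<tau>}. a < lam * deriv (\<phi> b0) \<xi>"
proof -
  define S where "S b = (SUP \<xi>\<in>{0<..\<tau>}. deriv (\<phi> b) \<xi>)" for b
  obtain b0 where b0: "b0 < m" "\<And>b. b < m \<Longrightarrow> S b \<le> S b0"
  proof -
    have "Max (S ` {..<m}) \<in> S ` {..<m}" using m by (intro Max_in) auto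
    then obtain b0 where "b0 < m" "S b0 = Max (S ` {..<m})" by auto
    thus ?thesis using that[of b0] by simp
  qed
  show thesis
  proof (rule that[OF b0(1)])
    fix b and \<xi> lam a :: real
    assume b: "b < m" and \<xi>: "\<xi> \<in> {0<..\<tau>}" and lam: "0 \<le> lam" and a: "0 < a"
      and lt: "a < lam * deriv (\<phi> b) \<xi>"
    have pos: "0 < lam" using lam a lt by (cases "lam = 0") auto
    hence "a / lam < deriv (\<phi> b) \<xi>" using lt by (simp add: field_simps)
    also have "\<dots> \<le> S b"
      unfolding S_def using \<xi> bdd_above_penalty_deriv[OF pen[OF b] H] by (intro cSUP_upper)
    also have "\<dots> \<le> S b0" using b0(2)[OF b] .
    finally obtain \<xi>' where "\<xi>' \<in> {0<..\<tau>}" "a / lam < deriv (\<phi> b0) \<xi>'"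
      unfolding S_def using \<tau> bdd_above_penalty_deriv[OF pen[OF b0(1)] H]
      by (subst (asm) less_cSUP_iff) auto
    thus "\<exists>\<xi>\<in>{0<..\<tau>}. a < lam * deriv (\<phi> b0) \<xi>" using pos by (auto simp: field_simps)
  qed
qed

text \<open>The multiples of \<open>\<sigma>\<close> and the cap at \<open>5 * \<sigma>\<close>
  match \<open>gaussian_interval_ge\<close>.\<close>

definition trap_noise :: "nat \<Rightarrow> nat \<Rightarrow> real \<Rightarrow> nat \<Rightarrow> rvec set" where
  "trap_noise n b0 \<sigma> b = rbox n {2 * b, 2 * b + 1, 2 * b0, 2 * b0 + 1}
     (\<lambda>i. if i = 2 * b then {4 * \<sigma>..5 * \<sigma>} else if i = 2 * b + 1 then {- 1 * \<sigma>..1 * \<sigma>}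
          else {- (1 / 4) * \<sigma>..1 / 4 * \<sigma>})"

definition trap_init :: "nat \<Rightarrow> nat \<Rightarrow> rvec set" where
  "trap_init d b0 = rbox d {2 * b0, 2 * b0 + 1} (\<lambda>_. {..0})"

lemma trap_noiseD:
  assumes "w \<in> trap_noise n b0 \<sigma> b" "b < n div 2" "b0 < n div 2" "b \<noteq> b0"
  shows "4 * \<sigma> \<le> w (2 * b)" "\<bar>w (2 * b + 1)\<bar> \<le> \<sigma>" "\<bar>w (2 * b0)\<bar> \<le> \<sigma> / 4" "\<bar>w (2 * b0 + 1)\<bar> \<le> \<sigma> / 4"
proof -
  have F: "2 * b < n" "2 * b + 1 < n" "2 * b0 < n" "2 * b0 + 1 < n" using assms by auto
  have "w i \<in> (if i = 2 * b then {4 * \<sigma>..5 * \<sigma>} else if i = 2 * b + 1 then {- 1 * \<sigma>..1 * \<sigma>}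
          else {- (1 / 4) * \<sigma>..1 / 4 * \<sigma>})" if "i \<in> {2 * b, 2 * b + 1, 2 * b0, 2 * b0 + 1}" for i
    using assms(1) F that unfolding trap_noise_def rbox_def by (auto dest!: PiE_mem[of _ _ _ i])
  from this[of "2 * b"] this[of "2 * b + 1"] this[of "2 * b0"] this[of "2 * b0 + 1"]
  show "4 * \<sigma> \<le> w (2 * b)" "\<bar>w (2 * b + 1)\<bar> \<le> \<sigma>" "\<bar>w (2 * b0)\<bar> \<le> \<sigma> / 4" "\<bar>w (2 * b0 + 1)\<bar> \<le> \<sigma> / 4"
    using assms(4) by (auto split: if_splits)
qed

lemma trap_initD:
  assumes "\<theta>0 \<in> trap_init d b0" "b0 < d div 2"
  shows "\<theta>0 (2 * b0) \<le> 0" "\<theta>0 (2 * b0 + 1) \<le> 0"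
proof -
  have "\<theta>0 i \<in> (if i \<in> {2 * b0, 2 * b0 + 1} then {..0} else UNIV)" if "i < d" for i
    using assms(1) that unfolding trap_init_def rbox_def by (auto dest!: PiE_mem[of _ _ _ i])
  from this[of "2 * b0"] this[of "2 * b0 + 1"]
  show "\<theta>0 (2 * b0) \<le> 0" "\<theta>0 (2 * b0 + 1) \<le> 0"
    using assms(2) by auto
qed

text \<open>Four noise coordinates, distinct because \<open>b \<noteq> b0\<close>, and two initial
  coordinates are constrained independently, each at a factor \<open>interval_mass\<close>.\<close>

lemma trap_event_ge:
  assumes U: "prob_space U" and \<sigma>: "0 < \<sigma>" and \<gamma>: "0 \<le> \<gamma>" and nd: "n \<le> d"
    and b: "b < n div 2" "b0 < n div 2" "b \<noteq> b0"
  defines "M \<equiv> gaussian_vec n \<sigma> \<Otimes>\<^sub>M (gaussian_vec d \<gamma> \<Otimes>\<^sub>M U)"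
    and "E \<equiv> trap_noise n b0 \<sigma> b \<times> (trap_init d b0 \<times> space U)"
  shows "E \<in> sets M" "ennreal (interval_mass ^ 6) \<le> emeasure M E"
proof -
  interpret U: prob_space U by fact
  interpret W: prob_space "gaussian_vec n \<sigma>" using \<sigma> by (intro prob_space_gaussian_vec) simp
  interpret T: prob_space "gaussian_vec d \<gamma>" using \<gamma> by (intro prob_space_gaussian_vec)
  interpret TU: pair_prob_space "gaussian_vec d \<gamma>" U ..
  have N: "trap_noise n b0 \<sigma> b \<in> sets (gaussian_vec n \<sigma>)"
    unfolding trap_noise_def by (rule rbox_sets) auto
  have I: "trap_init d b0 \<in> sets (gaussian_vec d \<gamma>)"
    unfolding trap_init_def by (rule rbox_sets) auto
  show "E \<in> sets M" unfolding E_def M_def using N I by auto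
  have cards: "card {2 * b, 2 * b + 1, 2 * b0, 2 * b0 + 1} = 4" "card {2 * b0, 2 * b0 + 1} = 2"
  proof -
    have "2 * b \<noteq> 2 * b0 + 1" "2 * b + 1 \<noteq> 2 * b0" by presburger+
    thus "card {2 * b, 2 * b + 1, 2 * b0, 2 * b0 + 1} = 4" "card {2 * b0, 2 * b0 + 1} = 2"
      using b(3) by auto
  qed
  have "ennreal interval_mass ^ card {2 * b, 2 * b + 1, 2 * b0, 2 * b0 + 1} \<le>
      emeasure (gaussian_vec n \<sigma>) (trap_noise n b0 \<sigma> b)"
    unfolding trap_noise_def
  proof (rule gaussian_vec_rbox_ge)
    fix i
    show "ennreal interval_mass \<le> emeasure (gaussian \<sigma>)
      (if i = 2 * b then {4 * \<sigma>..5 * \<sigma>} else if i = 2 * b + 1 then {- 1 * \<sigma>..1 * \<sigma>}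
       else {- (1 / 4) * \<sigma>..1 / 4 * \<sigma>})"
      using gaussian_interval_ge[OF \<sigma>, of 4 5] gaussian_interval_ge[OF \<sigma>, of "- 1" 1]
        gaussian_interval_ge[OF \<sigma>, of "- (1 / 4)" "1 / 4"] by auto
  qed (use \<sigma> b in auto)
  moreover have "ennreal interval_mass ^ card {2 * b0, 2 * b0 + 1} \<le>
      emeasure (gaussian_vec d \<gamma>) (trap_init d b0)"
    unfolding trap_init_def
    by (rule gaussian_vec_rbox_ge) (use \<gamma> b nd gaussian_nonpos_ge in auto)
  ultimately have "ennreal interval_mass ^ 4 * ennreal interval_mass ^ 2 \<le>
      emeasure (gaussian_vec n \<sigma>) (trap_noise n b0 \<sigma> b) * emeasure (gaussian_vec d \<gamma>) (trap_init d b0)"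
    unfolding cards by (intro mult_mono) auto
  also have "\<dots> = emeasure M E"
    unfolding M_def E_def using N I
    by (simp add: TU.emeasure_pair_measure_Times U.emeasure_pair_measure_Times U.emeasure_space_1)
  finally show "ennreal (interval_mass ^ 6) \<le> emeasure M E"
    using interval_mass_pos
    by (simp add: power_add[symmetric] ennreal_power flip: ennreal_mult')
qed

theorem theorem2:
  shows "\<exists>c::real. c > 0 \<and>
    (\<forall>(\<sigma>::real) (n::nat) (d::nat) (k::nat) (\<gamma>::real) (R::real).
      \<sigma> > 0 \<longrightarrow> n \<ge> 4 \<longrightarrow> d \<ge> n \<longrightarrow> k \<ge> 2 \<longrightarrow> \<gamma> \<ge> 0 \<longrightarrow> R \<ge> \<sigma> / sqrt (real n) \<longrightarrow>
      (\<exists>X::rmat. column_normalized n d X \<and>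
        (\<forall>\<rho> H \<eta> pick.
          regularizer d H \<rho> \<longrightarrow> admissible_stepsize n \<sigma> H \<eta> \<longrightarrow> tie_rule pick \<longrightarrow>
          (\<forall>y\<in>Rspace n. \<forall>\<theta>0\<in>Rspace d. \<forall>u. \<forall>lam\<ge>0.
             (\<exists>T. stops_at d (loss n d X y \<rho> lam) (\<eta> lam) pick u \<theta>0 T) \<and>
             local_minimum d (loss n d X y \<rho> lam)
               (descent_output d (loss n d X y \<rho> lam) (\<eta> lam) pick u \<theta>0)) \<and>
          (\<forall>U. prob_space U \<longrightarrow>
             (SUP \<theta>s \<in> B0 d k \<inter> B1 d R. expected_best_error n d X \<rho> \<eta> pick U \<sigma> \<gamma> \<theta>s)
               \<ge> ennreal (c * min R \<sigma> * (\<sigma> / sqrt (real n)))))))"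
proof (rule exI[of _ "interval_mass ^ 6 / 500"], intro conjI allI impI)
  \<comment> \<open>The power bounds the probability of one trap event; 500 is 5 times 100, from
    \<open>n \<le> 5 * card N\<close> and the threshold \<open>e\<^sup>2 / 100\<close> per
    block.\<close>
  show "0 < interval_mass ^ 6 / 500" using interval_mass_pos by simp
next
  fix \<sigma> \<gamma> R0 :: real and n d k :: nat
  assume \<sigma>: "0 < \<sigma>" and n: "4 \<le> n" and d: "n \<le> d" and k: "2 \<le> k" and \<gamma>: "0 \<le> \<gamma>"
    and R0: "\<sigma> / sqrt (real n) \<le> R0"
  define e where "e = \<sigma> / sqrt n"
  \<comment> \<open>The cap gives \<open>R \<le> e * sqrt n\<close>, so that the total cost of
    fitting the noise can reach the order of \<open>e * R\<close>.\<close>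
  define R where "R = min R0 \<sigma>"
  \<comment> \<open>Chosen to make \<open>sn\<^sup>2 * R = e / 4\<close>; since
    \<open>e \<le> R\<close>, \<open>sn\<close> is at most 1/2 and \<open>cs\<close> at least
    \<open>sqrt (3 / 4)\<close>.\<close>
  define sn where "sn = sqrt (e / (4 * R))"
  define cs where "cs = sqrt (1 - e / (4 * R))"
  define X where "X = block_matrix n cs sn"
  have root: "1 \<le> sqrt (real n)" using n by simp
  hence e_root: "e * sqrt n = \<sigma>" unfolding e_def using n by simp
  have e: "0 < e" using \<sigma> n by (simp add: e_def)
  have "e * 1 \<le> e * sqrt n" using e root by (intro mult_left_mono) auto
  hence eR: "e \<le> R" using R0 e_root by (simp add: R_def e_def)
  hence ratio: "0 < e / (4 * R)" "e / (4 * R) \<le> 1 / 4" using e by (auto simp: field_simps)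
  have sn_R: "sn\<^sup>2 * R = e / 4" using ratio e eR by (simp add: sn_def)
  have trig: "cs\<^sup>2 + sn\<^sup>2 = 1" "0 < sn" using ratio by (simp_all add: sn_def cs_def)
  have sn: "sn \<le> 1 / 2"
    unfolding sn_def by (rule real_le_lsqrt) (use ratio in \<open>auto simp: power2_eq_square\<close>)
  have cs: "4 / 5 \<le> cs"
    unfolding cs_def by (rule real_le_rsqrt) (use ratio in \<open>auto simp: power2_eq_square\<close>)
  show "\<exists>X::rmat. column_normalized n d X \<and>
        (\<forall>\<rho> H \<eta> pick.
          regularizer d H \<rho> \<longrightarrow> admissible_stepsize n \<sigma> H \<eta> \<longrightarrow> tie_rule pick \<longrightarrow>
          (\<forall>y\<in>Rspace n. \<forall>\<theta>0\<in>Rspace d. \<forall>u. \<forall>lam\<ge>0.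
             (\<exists>T. stops_at d (loss n d X y \<rho> lam) (\<eta> lam) pick u \<theta>0 T) \<and>
             local_minimum d (loss n d X y \<rho> lam)
               (descent_output d (loss n d X y \<rho> lam) (\<eta> lam) pick u \<theta>0)) \<and>
          (\<forall>U. prob_space U \<longrightarrow>
             (SUP \<theta>s \<in> B0 d k \<inter> B1 d R0. expected_best_error n d X \<rho> \<eta> pick U \<sigma> \<gamma> \<theta>s)
               \<ge> ennreal (interval_mass ^ 6 / 500 * min R0 \<sigma> * (\<sigma> / sqrt (real n)))))"
  proof (rule exI[of _ X], intro conjI allI impI ballI)
    show "column_normalized n d X" unfolding X_def using trig(1) by (rule block_matrix_normalized)
  next
    fix \<rho> H \<eta> pick
    assume reg: "regularizer d H \<rho>" and step: "admissible_stepsize n \<sigma> H \<eta>" and pick: "tie_rule pick"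
    obtain r where H: "0 \<le> H" and \<rho>: "\<And>\<theta>. \<theta> \<in> Rspace d \<Longrightarrow> \<rho> \<theta> = (\<Sum>j<d. r j (\<theta> j))"
      and pen: "\<And>j. j < d \<Longrightarrow> penalty H (r j)"
      using reg unfolding regularizer_iff by auto
    have loss: "block_loss n d cs sn \<rho> lam H r" if "0 \<le> lam" for lam
      by unfold_locales (use \<rho> pen that H trig cs n d in auto)
    have \<eta>: "0 < \<eta> lam" "\<eta> lam \<le> e / 4" "lam * H * \<eta> lam \<le> e / 4" if "0 \<le> lam" for lam
    proof -
      have *: "0 < \<eta> lam" "\<eta> lam \<le> e / 4" "lam * H \<noteq> 0 \<longrightarrow> \<eta> lam \<le> e / 4 / (lam * H)"
        using step that by (auto simp: admissible_stepsize_def Let_def e_def mult.commute)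
      show "0 < \<eta> lam" "\<eta> lam \<le> e / 4" using * by auto
      show "lam * H * \<eta> lam \<le> e / 4"
      proof (cases "lam * H = 0")
        case True
        thus ?thesis using e by (simp only: mult_zero_left)
      next
        case False
        hence "0 < lam * H" using that H by (simp add: less_le)
        thus ?thesis using *(3) False by (simp add: pos_le_divide_eq mult.commute)
      qed
    qed
    {
      fix y \<theta>0 u and lam :: real
      assume \<theta>0: "\<theta>0 \<in> Rspace d" and lam: "0 \<le> lam"
      interpret block_loss n d cs sn y \<rho> lam H r by (rule loss[OF lam])
      interpret local_descent d L "\<eta> lam" pick u \<theta>0
        using \<eta>[OF lam] pick \<theta>0 loss_continuous by unfold_locales
      show "\<exists>T. stops_at d (loss n d X y \<rho> lam) (\<eta> lam) pick u \<theta>0 T"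
        unfolding X_def by (rule descent_stops[OF \<eta>(1)[OF lam] pick \<theta>0])
      thus "local_minimum d (loss n d X y \<rho> lam)
               (descent_output d (loss n d X y \<rho> lam) (\<eta> lam) pick u \<theta>0)"
        unfolding X_def using outcome_local_minimum by blast
    }
    fix U :: "(real \<Rightarrow> nat \<Rightarrow> real) measure"
    assume U: "prob_space U"
    \<comment> \<open>\<open>b0\<close> depends on the penalty alone, not on \<open>lam\<close> or
      the noise, so the spike there is a legitimate true parameter.\<close>
    obtain b0 where b0: "b0 < n div 2" and steepest:
      "\<And>b \<xi> lam a. \<lbrakk>b < n div 2; \<xi> \<in> {0<..e / 4}; 0 \<le> lam; 0 < a; a < lam * deriv (r (2 * b)) \<xi>\<rbrakk> \<Longrightarrow>
         \<exists>\<xi>\<in>{0<..e / 4}. a < lam * deriv (r (2 * b0)) \<xi>"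
      by (rule exists_steepest[of "n div 2" H "\<lambda>b. r (2 * b)" "e / 4"]) (use pen H n d e in auto)
    define N where "N = {..<n div 2} - {b0}"
    define E where "E b = trap_noise n b0 \<sigma> b \<times> (trap_init d b0 \<times> space U)" for b
    \<comment> \<open>The error credited to each block whose event occurs; even if all occur, the
      total is only \<open>e * R / 500\<close>.\<close>
    define K where "K = e * R / (500 * real (card N))"
    let ?M = "gaussian_vec n \<sigma> \<Otimes>\<^sub>M (gaussian_vec d \<gamma> \<Otimes>\<^sub>M U)"
    let ?\<theta>s = "spike d b0 R"
    have cardN: "n \<le> 5 * card N" "0 < card N"
    proof -
      have "card N = n div 2 - 1" unfolding N_def using b0 by simp
      \<comment> \<open>Equality holds for \<open>n = 5\<close>.\<close>
      moreover have "n \<le> 5 * (n div 2 - 1)" "0 < n div 2 - 1" using n by presburger+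
      ultimately show "n \<le> 5 * card N" "0 < card N" by simp_all
    qed
    have K: "0 \<le> K" using e eR by (simp add: K_def)
    have "R \<le> e * (5 * real (card N))"
    proof -
      have "R \<le> e * sqrt n" unfolding e_root R_def by simp
      also have "\<dots> \<le> e * real n" using e root by (intro mult_left_mono) (auto simp: sqrt_le_D real_le_lsqrt power2_eq_square)
      also have "\<dots> \<le> e * real (5 * card N)" using e cardN(1) by (intro mult_left_mono) linarith+
      finally show ?thesis by simp
    qed
    hence K_e: "K \<le> e\<^sup>2 / 100"
      unfolding K_def using e cardN(2) by (simp add: field_simps power2_eq_square)
    have events: "E b \<in> sets ?M" "ennreal (interval_mass ^ 6) \<le> emeasure ?M (E b)" if "b \<in> N" for b
      using trap_event_ge[OF U \<sigma> \<gamma> d, of b b0] that b0 unfolding E_def N_def by auto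
    \<comment> \<open>A finite sum of indicators of measurable events lies below the integrand for
      all \<open>lam\<close> at once. It handles a possibly nonmeasurable infimum, and its integral
      follows by linearity.\<close>
    have pointwise: "(\<Sum>b\<in>N. ennreal K * indicator (E b) (w, \<theta>0, u)) \<le>
        (INF lam\<in>{0..}. ennreal (prediction_error n d X
           (descent_output d (loss n d X (observation n d X ?\<theta>s w) \<rho> lam) (\<eta> lam) pick (u lam) \<theta>0) ?\<theta>s))"
      if "\<theta>0 \<in> Rspace d" for w \<theta>0 u
    proof (rule INF_greatest)
      fix lam :: real assume "lam \<in> {0..}"
      hence lam: "0 \<le> lam" by simp
      define G where "G = {b \<in> N. (w, \<theta>0, u) \<in> E b}"
      have "(\<Sum>b\<in>N. ennreal K * indicator (E b) (w, \<theta>0, u)) = (\<Sum>b\<in>G. ennreal K)"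
        unfolding G_def by (rule sum.mono_neutral_cong_right) (auto simp: N_def indicator_def split: if_splits)
      also have "\<dots> = ennreal (real (card G) * K)" using K by (simp add: ennreal_mult' ennreal_of_nat_eq_real_of_nat)
      also have "\<dots> \<le> ennreal (prediction_error n d X
           (descent_output d (loss n d X (observation n d X ?\<theta>s w) \<rho> lam) (\<eta> lam) pick (u lam) \<theta>0) ?\<theta>s)"
      \<comment> \<open>For empty \<open>G\<close> the left side is 0. Otherwise any one of its
        events supplies the conditions on the initialization and on the noise of block
        \<open>b0\<close>.\<close>
      proof (cases "G = {}")
        case False
        then obtain b1 where b1: "b1 \<in> G" by blast
        have G: "4 * (e * sqrt n) \<le> w (2 * b)" "\<bar>w (2 * b + 1)\<bar> \<le> e * sqrt n"
          "\<bar>w (2 * b0)\<bar> \<le> e * sqrt n / 4" "\<bar>w (2 * b0 + 1)\<bar> \<le> e * sqrt n / 4" if "b \<in> G" for b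
          using that trap_noiseD[of w n b0 \<sigma> b] b0 unfolding e_root G_def E_def N_def by auto
        have "\<theta>0 \<in> trap_init d b0" using b1 by (simp add: G_def E_def)
        hence init: "\<theta>0 (2 * b0) \<le> 0" "\<theta>0 (2 * b0 + 1) \<le> 0"
          using trap_initD[of \<theta>0 d b0] b0 d by auto
        define y where "y = observation n d X ?\<theta>s w"
        interpret block_loss n d cs sn y \<rho> lam H r by (rule loss[OF lam])
        have "real (card G) * K \<le> min (real (card G) * (e\<^sup>2 / 100)) (e * R / 32)"
        proof (rule min.boundedI)
          show "real (card G) * K \<le> real (card G) * (e\<^sup>2 / 100)" using K_e by (intro mult_left_mono) auto
          have "card G \<le> card N" unfolding G_def N_def by (rule card_mono) auto
          hence "real (card G) * K \<le> real (card N) * K" using K by (intro mult_right_mono) auto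
          also have "\<dots> = e * R / 500" using cardN(2) by (simp add: K_def)
          also have "\<dots> \<le> e * R / 32" using e eR by (simp add: field_simps)
          finally show "real (card G) * K \<le> e * R / 32" .
        qed
        also have "\<dots> \<le> prediction_error n d (block_matrix n cs sn)
            (descent_output d L (\<eta> lam) pick (u lam) \<theta>0) ?\<theta>s"
        proof (rule outcome_error[OF \<eta>[OF lam] pick that init b0 e eR cs sn sn_R])
          show "\<exists>\<xi>\<in>{0<..e / 4}. 4 * e < lam * deriv (r (2 * b0)) \<xi>"
            if "b < n div 2" "\<xi> \<in> {0<..e / 4}" "4 * e < lam * deriv (r (2 * b)) \<xi>" for b \<xi>
            using steepest[OF that(1,2) lam _ that(3)] e by simp
          show "y = observation n d (block_matrix n cs sn) ?\<theta>s w" by (simp add: y_def X_def)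
          show "G \<subseteq> {..<n div 2} - {b0}" by (auto simp: G_def N_def)
        qed (use G b1 in auto)
        finally show ?thesis by (simp add: X_def y_def ennreal_leI)
      qed simp
      finally show "(\<Sum>b\<in>N. ennreal K * indicator (E b) (w, \<theta>0, u)) \<le> ennreal (prediction_error n d X
           (descent_output d (loss n d X (observation n d X ?\<theta>s w) \<rho> lam) (\<eta> lam) pick (u lam) \<theta>0) ?\<theta>s)" .
    qed
    \<comment> \<open>The number of noise blocks cancels against the denominator of
      \<open>K\<close>, so the constant is free of \<open>n\<close>.\<close>
    have "interval_mass ^ 6 / 500 * min R0 \<sigma> * (\<sigma> / sqrt (real n)) = real (card N) * (K * interval_mass ^ 6)"
      using cardN(2) by (simp add: K_def R_def e_def mult_ac)
    also have "ennreal \<dots> = (\<Sum>b\<in>N. ennreal K * ennreal (interval_mass ^ 6))"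
      using K interval_mass_pos by (simp add: ennreal_mult' ennreal_of_nat_eq_real_of_nat)
    also have "\<dots> \<le> (\<Sum>b\<in>N. ennreal K * emeasure ?M (E b))"
      using events by (intro sum_mono mult_left_mono) auto
    also have "\<dots> = (\<integral>\<^sup>+x. (\<Sum>b\<in>N. ennreal K * indicator (E b) x) \<partial>?M)"
      using events(1) by (subst nn_integral_sum) (auto simp: nn_integral_cmult_indicator)
    also have "\<dots> \<le> expected_best_error n d X \<rho> \<eta> pick U \<sigma> \<gamma> ?\<theta>s"
      unfolding expected_best_error_def
    proof (rule nn_integral_mono)
      fix x assume "x \<in> space ?M"
      moreover obtain w \<theta>0 u where x: "x = (w, \<theta>0, u)" by (cases x)
      ultimately have "\<theta>0 \<in> Rspace d"
        by (auto simp: space_pair_measure gaussian_vec_def space_PiM Rspace_def)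
      thus "(\<Sum>b\<in>N. ennreal K * indicator (E b) x) \<le> (case x of (w, \<theta>0, u) \<Rightarrow>
          INF lam\<in>{0..}. ennreal (prediction_error n d X
           (descent_output d (loss n d X (observation n d X ?\<theta>s w) \<rho> lam) (\<eta> lam) pick (u lam) \<theta>0) ?\<theta>s))"
        unfolding x prod.case by (rule pointwise)
    qed
    also have "\<dots> \<le> (SUP \<theta>s \<in> B0 d k \<inter> B1 d R0. expected_best_error n d X \<rho> \<eta> pick U \<sigma> \<gamma> \<theta>s)"
    proof (rule SUP_upper)
      show "?\<theta>s \<in> B0 d k \<inter> B1 d R0"
        using spike_in_B0[OF k] b0 d e eR by (auto intro!: spike_in_B1 simp: R_def)
    qed
    finally show "ennreal (interval_mass ^ 6 / 500 * min R0 \<sigma> * (\<sigma> / sqrt (real n))) \<le>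
        (SUP \<theta>s \<in> B0 d k \<inter> B1 d R0. expected_best_error n d X \<rho> \<eta> pick U \<sigma> \<gamma> \<theta>s)" .
  qed
qed

end
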